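(* Every nonzero even-quadratic odd-symplectic Lie superalgebra $(\mathfrak g,B,\omega)$ is a generalized double extension of an even-quadratic odd-symplectic Lie superalgebra $(\mathfrak h,B_{\mathfrak h},\omega_{\mathfrak h})$ by the two-dimensional abelian Lie superalgebra.
   Context: All Lie superalgebras are finite dimensional over an algebraically closed field $\mathbb K$ of characteristic zero; $|x|\in\mathbb Z_2$ is the degree of a homogeneous $X$. A bilinear form $\theta$ is even if $\theta(\mathfrak g_\alpha,\mathfrak g_\beta)=\{0\}$ for $\alpha\ne\beta$, odd if $\theta(\mathfrak g_\alpha,\mathfrak g_\alpha)=\{0\}$ for all $\alpha$. An even-invariant scalar product $B$ is an even, supersymmetric ($B(X,Y)=(-1)^{|x||y|}B(Y,X)$), invariant ($B([X,Y],Z)=B(X,[Y,Z])$), non-degenerate bilinear form. An odd-symplectic form is an odd, skew-supersymmetric ($\omega(X,Y)=-(-1)^{|x||y|}\omega(Y,X)$), non-degenerate form with $(-1)^{|z||x|}\omega(X,[Y,Z])+(-1)^{|x||y|}\omega(Y,[Z,X])+(-1)^{|y||z|}\omega(Z,[X,Y])=0$. An even-quadratic odd-symplectic Lie superalgebra $(\mathfrak g,B,\omega)$ carries both; then there is a unique odd invertible superderivation $\delta$ with $\omega(X,Y)=B(\delta(X),Y)$, and it is skew-supersymmetric. A superderivation $\Delta$ of degree $d$ satisfies $\Delta(\mathfrak g_\alpha)\subseteq \mathfrak g_{\alpha+d}$ and $\Delta[X,Y]=[\Delta(X),Y]+(-1)^{d|x|}[X,\Delta(Y)]$; it is skew-supersymmetric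 for $B$ if $B(\Delta(X),Y)=-(-1)^{d|x|}B(X,\Delta(Y))$. Brackets of endomorphisms are supercommutators. Generalized double extension by the two-dimensional abelian Lie superalgebra $\mathbb Ke_0\oplus\mathbb Ke_1$ ($e_0$ even, $e_1$ odd). Let $(\mathfrak h,B,\omega)$ be even-quadratic odd-symplectic with associated odd invertible superderivation $\delta$. Let $D$ (even), $\bar D$ (odd) be skew-supersymmetric superderivations of $(\mathfrak h,B)$, $x_0,c_0\in\mathfrak h_{\bar0}$, $x_1,c_1\in\mathfrak h_{\bar1}$, $k,\alpha\in\mathbb K$, $\lambda\in\mathbb K\setminus\{0\}$ with $\bar D^2=\frac12\mathrm{ad}(x_0)$, $\bar D(x_0)=0$, $B(x_0,x_0)=0$, $[D,\bar D]=\mathrm{ad}(x_1)$, $D(x_0)=2\bar D(x_1)$, and $[\delta,D]-\lambda\bar D=\mathrm{ad}(c_1)$, $[\delta,\bar D]+\lambda D=\mathrm{ad}(c_0)$, $\delta(x_0)=-2\lambda x_1-2\bar D(c_0)$, $\delta(x_1)=\lambda x_0+D(c_0)+\bar D(c_1)$, $\lambda k=B(c_0,x_0)$. On $\mathfrak t=\mathbb Ke_0^*\oplus\mathbb Ke_1^*\oplus\mathfrak h\oplus\mathbb Ke_0\oplus\mathbb Ke_1$ ($e_0^*$ even, $e_1^*$ odd, both central) put $[X,Y]=[X,Y]_{\mathfrak h}-B(\bar D(X),Y)e_1^*+B(D(X),Y)e_0^*$, $[e_0,X]=D(X)+B(x_1,X)e_1^*$, $[e_1,X]=\bar D(X)-B(x_0,X)e_1^*+B(x_1,X)e_0^*$,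 $[e_1,e_1]=ke_0^*+x_0$, $[e_0,e_1]=ke_1^*+x_1$, $[e_0,e_0]=0$; let $\gamma$ be the supersymmetric form with $\gamma|_{\mathfrak h\times\mathfrak h}=B$, $\gamma(e_0^*,e_0)=1=\gamma(e_1^*,e_1)$, other pairings zero (up to supersymmetry); let $\Delta(e_0^* )=\lambda e_1^*$, $\Delta(e_1^* )=\lambda e_0^*$, $\Delta(e_0)=\alpha e_1^*+c_1+\lambda e_1$, $\Delta(e_1)=-\alpha e_0^*+c_0-\lambda e_0$, $\Delta(X)=-B(c_1,X)e_0^*+\delta(X)-B(c_0,X)e_1^*$. Then $(\mathfrak t,\gamma,\Omega)$ with $\Omega(X,Y)=\gamma(\Delta(X),Y)$ is an even-quadratic odd-symplectic Lie superalgebra, called the generalized double extension of $(\mathfrak h,B,\omega)$ by the two-dimensional abelian Lie superalgebra by means of $(D,\bar D,x_0,x_1,c_0,c_1,\lambda)$. "Is a generalized double extension" means up to isomorphism preserving both forms. *)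

theory Defs
  imports "HOL-Computational_Algebra.Computational_Algebra" "HOL-Library.Z2"
    "HOL-Library.Product_Plus"
begin

text \<open>
  A superspace is a finite-dimensional subspace of an ambient vector space, given by its
  homogeneous components \<open>G 0\<close> and \<open>G 1\<close>, where \<open>G :: bit \<Rightarrow> 'v set\<close> and \<^typ>\<open>bit\<close> is the ring of
  integers mod 2.  Brackets, forms and maps are functions on the whole ambient type, but all
  conditions are relative to the carrier \<open>G 0 \<oplus> G 1\<close>.
\<close>

definition super_carrier :: "(bit \<Rightarrow> 'v::ab_group_add set) \<Rightarrow> 'v set" where
  "super_carrier G = {x + y | x y. x \<in> G 0 \<and> y \<in> G 1}"

text \<open>The sign \<open>(-1)\<^sup>a\<^sup>b\<close> for degrees \<open>a\<close>, \<open>b\<close>.\<close>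

definition ksign :: "bit \<Rightarrow> bit \<Rightarrow> 'k::ring_1" where
  "ksign a b = (if a * b = 1 then - 1 else 1)"

definition linear_map_on ::
  "('k \<Rightarrow> 'v \<Rightarrow> 'v::ab_group_add) \<Rightarrow> ('k \<Rightarrow> 'w \<Rightarrow> 'w::ab_group_add) \<Rightarrow> 'v set \<Rightarrow> ('v \<Rightarrow> 'w) \<Rightarrow> bool" where
  "linear_map_on s s' V f \<longleftrightarrow>
     (\<forall>x\<in>V. \<forall>y\<in>V. f (x + y) = f x + f y) \<and> (\<forall>c. \<forall>x\<in>V. f (s c x) = s' c (f x))"

definition bilinear_map_on ::
  "('k \<Rightarrow> 'v \<Rightarrow> 'v::ab_group_add) \<Rightarrow> ('k \<Rightarrow> 'w \<Rightarrow> 'w::ab_group_add) \<Rightarrow> 'v set \<Rightarrow> ('v \<Rightarrow> 'v \<Rightarrow> 'w) \<Rightarrow> bool" where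
  "bilinear_map_on s s' V f \<longleftrightarrow>
     (\<forall>x\<in>V. linear_map_on s s' V (f x)) \<and> (\<forall>y\<in>V. linear_map_on s s' V (\<lambda>x. f x y))"

locale superspace = vector_space scale
  for scale :: "'k::{alg_closed_field, field_char_0} \<Rightarrow> 'v::ab_group_add \<Rightarrow> 'v" +
  fixes G :: "bit \<Rightarrow> 'v set"
  assumes subspace_component: "subspace (G a)"
    and components_disjoint: "G 0 \<inter> G 1 = {0}"
    and finite_dimensional: "\<exists>S. finite S \<and> span S = super_carrier G"

locale lie_superalgebra = superspace scale G
  for scale :: "'k::{alg_closed_field, field_char_0} \<Rightarrow> 'v::ab_group_add \<Rightarrow> 'v"
    and G :: "bit \<Rightarrow> 'v set" +
  fixes br :: "'v \<Rightarrow> 'v \<Rightarrow> 'v"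
  assumes br_bilinear: "bilinear_map_on scale scale (super_carrier G) br"
    and br_graded: "\<lbrakk>x \<in> G a; y \<in> G b\<rbrakk> \<Longrightarrow> br x y \<in> G (a + b)"
    and br_skew: "\<lbrakk>x \<in> G a; y \<in> G b\<rbrakk> \<Longrightarrow> br x y = - scale (ksign a b) (br y x)"
    and br_jacobi: "\<lbrakk>x \<in> G a; y \<in> G b; z \<in> G c\<rbrakk> \<Longrightarrow>
      scale (ksign a c) (br x (br y z)) + scale (ksign a b) (br y (br z x))
        + scale (ksign b c) (br z (br x y)) = 0"

definition even_form :: "(bit \<Rightarrow> 'v set) \<Rightarrow> ('v \<Rightarrow> 'v \<Rightarrow> 'k::zero) \<Rightarrow> bool" where
  "even_form G f \<longleftrightarrow> (\<forall>a b. a \<noteq> b \<longrightarrow> (\<forall>x\<in>G a. \<forall>y\<in>G b. f x y = 0))"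

definition odd_form :: "(bit \<Rightarrow> 'v set) \<Rightarrow> ('v \<Rightarrow> 'v \<Rightarrow> 'k::zero) \<Rightarrow> bool" where
  "odd_form G f \<longleftrightarrow> (\<forall>a. \<forall>x\<in>G a. \<forall>y\<in>G a. f x y = 0)"

definition nondegenerate_on :: "'v::zero set \<Rightarrow> ('v \<Rightarrow> 'v \<Rightarrow> 'k::zero) \<Rightarrow> bool" where
  "nondegenerate_on V f \<longleftrightarrow>
     (\<forall>x\<in>V. (\<forall>y\<in>V. f x y = 0) \<longrightarrow> x = 0) \<and> (\<forall>y\<in>V. (\<forall>x\<in>V. f x y = 0) \<longrightarrow> y = 0)"

locale even_quadratic_odd_symplectic = lie_superalgebra scale G br
  for scale :: "'k::{alg_closed_field, field_char_0} \<Rightarrow> 'v::ab_group_add \<Rightarrow> 'v"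
    and G :: "bit \<Rightarrow> 'v set" and br :: "'v \<Rightarrow> 'v \<Rightarrow> 'v" +
  fixes B \<omega> :: "'v \<Rightarrow> 'v \<Rightarrow> 'k"
  assumes B_bilinear: "bilinear_map_on scale (*) (super_carrier G) B"
    and B_even: "even_form G B"
    and B_supersym: "\<lbrakk>x \<in> G a; y \<in> G b\<rbrakk> \<Longrightarrow> B x y = ksign a b * B y x"
    and B_invariant: "\<lbrakk>x \<in> super_carrier G; y \<in> super_carrier G; z \<in> super_carrier G\<rbrakk> \<Longrightarrow> B (br x y) z = B x (br y z)"
    and B_nondegenerate: "nondegenerate_on (super_carrier G) B"
    and \<omega>_bilinear: "bilinear_map_on scale (*) (super_carrier G) \<omega>"
    and \<omega>_odd: "odd_form G \<omega>"
    and \<omega>_skew: "\<lbrakk>x \<in> G a; y \<in> G b\<rbrakk> \<Longrightarrow> \<omega> x y = - (ksign a b * \<omega> y x)"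
    and \<omega>_nondegenerate: "nondegenerate_on (super_carrier G) \<omega>"
    and \<omega>_cocycle: "\<lbrakk>x \<in> G a; y \<in> G b; z \<in> G c\<rbrakk> \<Longrightarrow>
      ksign c a * \<omega> x (br y z) + ksign a b * \<omega> y (br z x) + ksign b c * \<omega> z (br x y) = 0"

definition superderivation ::
  "('k::ring_1 \<Rightarrow> 'v \<Rightarrow> 'v::ab_group_add) \<Rightarrow> (bit \<Rightarrow> 'v set) \<Rightarrow> ('v \<Rightarrow> 'v \<Rightarrow> 'v) \<Rightarrow> bit \<Rightarrow> ('v \<Rightarrow> 'v) \<Rightarrow> bool" where
  "superderivation scale G br d f \<longleftrightarrow>
     linear_map_on scale scale (super_carrier G) f \<and>
     (\<forall>a. f ` G a \<subseteq> G (a + d)) \<and>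
     (\<forall>a. \<forall>x\<in>G a. \<forall>y\<in>super_carrier G. f (br x y) = br (f x) y + scale (ksign d a) (br x (f y)))"

definition skew_supersymmetric ::
  "(bit \<Rightarrow> 'v::ab_group_add set) \<Rightarrow> ('v \<Rightarrow> 'v \<Rightarrow> 'k::ring_1) \<Rightarrow> bit \<Rightarrow> ('v \<Rightarrow> 'v) \<Rightarrow> bool" where
  "skew_supersymmetric G B d f \<longleftrightarrow>
     (\<forall>a. \<forall>x\<in>G a. \<forall>y\<in>super_carrier G. B (f x) y = - (ksign d a * B x (f y)))"

text \<open>The supercommutator of endomorphisms \<open>f\<close>, \<open>g\<close> of degrees \<open>a\<close>, \<open>b\<close>.\<close>

definition supercommutator ::
  "('k::ring_1 \<Rightarrow> 'v \<Rightarrow> 'v::ab_group_add) \<Rightarrow> bit \<Rightarrow> bit \<Rightarrow> ('v \<Rightarrow> 'v) \<Rightarrow> ('v \<Rightarrow> 'v) \<Rightarrow> 'v \<Rightarrow> 'v" where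
  "supercommutator scale a b f g x = f (g x) - scale (ksign a b) (g (f x))"

text \<open>
  The odd invertible superderivation \<open>\<delta>\<close> with \<open>\<omega>(X,Y) = B(\<delta>(X),Y)\<close>; by non-degeneracy of \<open>B\<close>
  it is uniquely determined on the carrier.
\<close>

definition associated_derivation ::
  "('k::ring_1 \<Rightarrow> 'v \<Rightarrow> 'v::ab_group_add) \<Rightarrow> (bit \<Rightarrow> 'v set) \<Rightarrow> ('v \<Rightarrow> 'v \<Rightarrow> 'v) \<Rightarrow>
   ('v \<Rightarrow> 'v \<Rightarrow> 'k) \<Rightarrow> ('v \<Rightarrow> 'v \<Rightarrow> 'k) \<Rightarrow> ('v \<Rightarrow> 'v) \<Rightarrow> bool" where
  "associated_derivation scale G br B \<omega> \<delta> \<longleftrightarrow>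
     superderivation scale G br 1 \<delta> \<and> bij_betw \<delta> (super_carrier G) (super_carrier G) \<and>
     (\<forall>x\<in>super_carrier G. \<forall>y\<in>super_carrier G. \<omega> x y = B (\<delta> x) y)"

text \<open>The data \<open>(\<delta>, D, D', x\<^sub>0, x\<^sub>1, c\<^sub>0, c\<^sub>1, k, \<lambda>)\<close> on \<open>\<hh>\<close>; \<open>Db\<close> is \<open>D'\<close> (\<open>D\<close> with a bar), \<open>l\<close> is \<open>\<lambda>\<close>.\<close>

locale double_extension_data = even_quadratic_odd_symplectic scale H br B \<omega>
  for scale :: "'k::{alg_closed_field, field_char_0} \<Rightarrow> 'v::ab_group_add \<Rightarrow> 'v"
    and H :: "bit \<Rightarrow> 'v set" and br :: "'v \<Rightarrow> 'v \<Rightarrow> 'v" and B \<omega> :: "'v \<Rightarrow> 'v \<Rightarrow> 'k" +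
  fixes \<delta> D Db :: "'v \<Rightarrow> 'v" and x0 x1 c0 c1 :: 'v and k l :: 'k
  assumes \<delta>_associated: "associated_derivation scale H br B \<omega> \<delta>"
    and D_derivation: "superderivation scale H br 0 D" "skew_supersymmetric H B 0 D"
    and Db_derivation: "superderivation scale H br 1 Db" "skew_supersymmetric H B 1 Db"
    and in_even: "x0 \<in> H 0" "c0 \<in> H 0"
    and in_odd: "x1 \<in> H 1" "c1 \<in> H 1"
    and l_nonzero: "l \<noteq> 0"
    and Db_squared: "X \<in> super_carrier H \<Longrightarrow> Db (Db X) = scale (1/2) (br x0 X)"
    and Db_x0: "Db x0 = 0"
    and B_x0_x0: "B x0 x0 = 0"
    and D_Db: "X \<in> super_carrier H \<Longrightarrow> supercommutator scale 0 1 D Db X = br x1 X"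
    and D_x0: "D x0 = scale 2 (Db x1)"
    and \<delta>_D: "X \<in> super_carrier H \<Longrightarrow> supercommutator scale 1 0 \<delta> D X - scale l (Db X) = br c1 X"
    and \<delta>_Db: "X \<in> super_carrier H \<Longrightarrow> supercommutator scale 1 1 \<delta> Db X + scale l (D X) = br c0 X"
    and \<delta>_x0: "\<delta> x0 = - scale (2 * l) x1 - scale 2 (Db c0)"
    and \<delta>_x1: "\<delta> x1 = scale l x0 + D c0 + Db c1"
    and l_k: "l * k = B c0 x0"

text \<open>
  The space \<open>\<tt> = \<bbbK>e\<^sub>0\<^sup>* \<oplus> \<bbbK>e\<^sub>1\<^sup>* \<oplus> \<hh> \<oplus> \<bbbK>e\<^sub>0 \<oplus> \<bbbK>e\<^sub>1\<close>: the tuple \<open>(a, b, X, p, q)\<close> stands for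
  \<open>a e\<^sub>0\<^sup>* + b e\<^sub>1\<^sup>* + X + p e\<^sub>0 + q e\<^sub>1\<close>.
\<close>

type_synonym ('k, 'v) dext = "'k \<times> 'k \<times> 'v \<times> 'k \<times> 'k"

fun dext_scale :: "('k \<Rightarrow> 'v \<Rightarrow> 'v) \<Rightarrow> 'k::times \<Rightarrow> ('k, 'v) dext \<Rightarrow> ('k, 'v) dext" where
  "dext_scale scale c (a, b, X, p, q) = (c * a, c * b, scale c X, c * p, c * q)"

definition dext_grading :: "(bit \<Rightarrow> 'v set) \<Rightarrow> bit \<Rightarrow> ('k::zero, 'v) dext set" where
  "dext_grading H d =
     (if d = 0 then {(a, 0, X, p, 0) | a X p. X \<in> H 0} else {(0, b, X, 0, q) | b X q. X \<in> H 1})"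

text \<open>The parity automorphism \<open>X\<^sub>0 + X\<^sub>1 \<mapsto> X\<^sub>0 - X\<^sub>1\<close>.\<close>

definition parity_aut :: "(bit \<Rightarrow> 'v::ab_group_add set) \<Rightarrow> 'v \<Rightarrow> 'v" where
  "parity_aut H X = (THE Z. \<exists>u\<in>H 0. \<exists>v\<in>H 1. X = u + v \<and> Z = u - v)"

text \<open>\<open>[X, Y]\<close> for \<open>X, Y \<in> \<hh>\<close>, and \<open>[e\<^sub>0, X]\<close>, \<open>[e\<^sub>1, X]\<close>, \<open>[e\<^sub>0, e\<^sub>1]\<close>, \<open>[e\<^sub>1, e\<^sub>1]\<close>:\<close>

definition br_hh :: "('v \<Rightarrow> 'v \<Rightarrow> 'v) \<Rightarrow> ('v \<Rightarrow> 'v \<Rightarrow> 'k::ring_1) \<Rightarrow> ('v \<Rightarrow> 'v) \<Rightarrow> ('v \<Rightarrow> 'v) \<Rightarrow>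
    'v \<Rightarrow> 'v \<Rightarrow> ('k, 'v) dext" where
  "br_hh br B D Db X Y = (B (D X) Y, - B (Db X) Y, br X Y, 0, 0)"

definition br_e0h :: "('v \<Rightarrow> 'v \<Rightarrow> 'k::ring_1) \<Rightarrow> ('v \<Rightarrow> 'v) \<Rightarrow> 'v \<Rightarrow> 'v \<Rightarrow> ('k, 'v) dext" where
  "br_e0h B D x1 X = (0, B x1 X, D X, 0, 0)"

definition br_e1h :: "('v \<Rightarrow> 'v \<Rightarrow> 'k::ring_1) \<Rightarrow> ('v \<Rightarrow> 'v) \<Rightarrow> 'v \<Rightarrow> 'v \<Rightarrow> 'v \<Rightarrow> ('k, 'v) dext" where
  "br_e1h B Db x0 x1 X = (B x1 X, - B x0 X, Db X, 0, 0)"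

definition br_e0e1 :: "'v \<Rightarrow> 'k::ring_1 \<Rightarrow> ('k, 'v) dext" where
  "br_e0e1 x1 k = (0, k, x1, 0, 0)"

definition br_e1e1 :: "'v \<Rightarrow> 'k::ring_1 \<Rightarrow> ('k, 'v) dext" where
  "br_e1e1 x0 k = (k, 0, x0, 0, 0)"

text \<open>
  Bilinear super-skew-symmetric extension of these brackets: \<open>[X, e\<^sub>0] = - [e\<^sub>0, X]\<close>,
  \<open>[e\<^sub>1, e\<^sub>0] = - [e\<^sub>0, e\<^sub>1]\<close>, and \<open>[X, e\<^sub>1] = - (-1)\<^sup>|\<^sup>X\<^sup>| [e\<^sub>1, X]\<close>, which for inhomogeneous \<open>X\<close>
  involves the parity automorphism.
\<close>

fun dext_bracket ::
  "('k \<Rightarrow> 'v \<Rightarrow> 'v) \<Rightarrow> (bit \<Rightarrow> 'v set) \<Rightarrow> ('v \<Rightarrow> 'v \<Rightarrow> 'v) \<Rightarrow> ('v \<Rightarrow> 'v \<Rightarrow> 'k) \<Rightarrow>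
   ('v \<Rightarrow> 'v) \<Rightarrow> ('v \<Rightarrow> 'v) \<Rightarrow> 'v \<Rightarrow> 'v \<Rightarrow> 'k \<Rightarrow>
   ('k::comm_ring_1, 'v::ab_group_add) dext \<Rightarrow> ('k, 'v) dext \<Rightarrow> ('k, 'v) dext" where
  "dext_bracket scale H br B D Db x0 x1 k (a, b, X, p, q) (a', b', X', p', q') =
     br_hh br B D Db X X'
     + dext_scale scale p (br_e0h B D x1 X')
     - dext_scale scale p' (br_e0h B D x1 X)
     + dext_scale scale q (br_e1h B Db x0 x1 X')
     - dext_scale scale q' (br_e1h B Db x0 x1 (parity_aut H X))
     + dext_scale scale (p * q' - q * p') (br_e0e1 x1 k)
     + dext_scale scale (q * q') (br_e1e1 x0 k)"

text \<open>By supersymmetry \<open>\<gamma>(e\<^sub>1, e\<^sub>1\<^sup>*) = - \<gamma>(e\<^sub>1\<^sup>*, e\<^sub>1) = - 1\<close>.\<close>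

fun dext_form ::
  "('v \<Rightarrow> 'v \<Rightarrow> 'k) \<Rightarrow> ('k::comm_ring_1, 'v) dext \<Rightarrow> ('k, 'v) dext \<Rightarrow> 'k" where
  "dext_form B (a, b, X, p, q) (a', b', X', p', q') =
     B X X' + a * p' + p * a' + b * q' - q * b'"

fun dext_derivation ::
  "('k \<Rightarrow> 'v \<Rightarrow> 'v) \<Rightarrow> ('v \<Rightarrow> 'v \<Rightarrow> 'k) \<Rightarrow> ('v \<Rightarrow> 'v) \<Rightarrow> 'v \<Rightarrow> 'v \<Rightarrow> 'k \<Rightarrow> 'k \<Rightarrow>
   ('k::comm_ring_1, 'v::ab_group_add) dext \<Rightarrow> ('k, 'v) dext" where
  "dext_derivation scale B \<delta> c0 c1 \<alpha> l (a, b, X, p, q) =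
     dext_scale scale a (0, l, 0, 0, 0)
     + dext_scale scale b (l, 0, 0, 0, 0)
     + (- B c1 X, - B c0 X, \<delta> X, 0, 0)
     + dext_scale scale p (0, \<alpha>, c1, 0, l)
     + dext_scale scale q (- \<alpha>, 0, c0, - l, 0)"

definition dext_omega ::
  "('k \<Rightarrow> 'v \<Rightarrow> 'v) \<Rightarrow> ('v \<Rightarrow> 'v \<Rightarrow> 'k) \<Rightarrow> ('v \<Rightarrow> 'v) \<Rightarrow> 'v \<Rightarrow> 'v \<Rightarrow> 'k \<Rightarrow> 'k \<Rightarrow>
   ('k::comm_ring_1, 'v::ab_group_add) dext \<Rightarrow> ('k, 'v) dext \<Rightarrow> 'k" where
  "dext_omega scale B \<delta> c0 c1 \<alpha> l U V = dext_form B (dext_derivation scale B \<delta> c0 c1 \<alpha> l U) V"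

text \<open>Isomorphisms of Lie superalgebras (even, linear, bijective) preserving both forms.\<close>

definition isometric_iso ::
  "('k \<Rightarrow> 'v \<Rightarrow> 'v::ab_group_add) \<Rightarrow> (bit \<Rightarrow> 'v set) \<Rightarrow> ('v \<Rightarrow> 'v \<Rightarrow> 'v) \<Rightarrow>
   ('v \<Rightarrow> 'v \<Rightarrow> 'k) \<Rightarrow> ('v \<Rightarrow> 'v \<Rightarrow> 'k) \<Rightarrow>
   ('k \<Rightarrow> 'w \<Rightarrow> 'w::ab_group_add) \<Rightarrow> (bit \<Rightarrow> 'w set) \<Rightarrow> ('w \<Rightarrow> 'w \<Rightarrow> 'w) \<Rightarrow>
   ('w \<Rightarrow> 'w \<Rightarrow> 'k) \<Rightarrow> ('w \<Rightarrow> 'w \<Rightarrow> 'k) \<Rightarrow> ('v \<Rightarrow> 'w) \<Rightarrow> bool" where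
  "isometric_iso s G br B \<omega> s' G' br' B' \<omega>' \<phi> \<longleftrightarrow>
     linear_map_on s s' (super_carrier G) \<phi> \<and>
     bij_betw \<phi> (super_carrier G) (super_carrier G') \<and>
     (\<forall>d. \<phi> ` G d \<subseteq> G' d) \<and>
     (\<forall>x\<in>super_carrier G. \<forall>y\<in>super_carrier G. \<phi> (br x y) = br' (\<phi> x) (\<phi> y)) \<and>
     (\<forall>x\<in>super_carrier G. \<forall>y\<in>super_carrier G. B' (\<phi> x) (\<phi> y) = B x y) \<and>
     (\<forall>x\<in>super_carrier G. \<forall>y\<in>super_carrier G. \<omega>' (\<phi> x) (\<phi> y) = \<omega> x y)"

definition is_generalized_double_extension ::
  "('k::{alg_closed_field, field_char_0} \<Rightarrow> 'v \<Rightarrow> 'v::ab_group_add) \<Rightarrow> (bit \<Rightarrow> 'v set) \<Rightarrow>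
   ('v \<Rightarrow> 'v \<Rightarrow> 'v) \<Rightarrow> ('v \<Rightarrow> 'v \<Rightarrow> 'k) \<Rightarrow> ('v \<Rightarrow> 'v \<Rightarrow> 'k) \<Rightarrow>
   ('k \<Rightarrow> 'w \<Rightarrow> 'w::ab_group_add) \<Rightarrow> (bit \<Rightarrow> 'w set) \<Rightarrow>
   ('w \<Rightarrow> 'w \<Rightarrow> 'w) \<Rightarrow> ('w \<Rightarrow> 'w \<Rightarrow> 'k) \<Rightarrow> ('w \<Rightarrow> 'w \<Rightarrow> 'k) \<Rightarrow> bool" where
  "is_generalized_double_extension s G br B \<omega> s\<^sub>h H br\<^sub>h B\<^sub>h \<omega>\<^sub>h \<longleftrightarrow>
     (\<exists>\<delta> D Db x0 x1 c0 c1 k \<alpha> l.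
        double_extension_data s\<^sub>h H br\<^sub>h B\<^sub>h \<omega>\<^sub>h \<delta> D Db x0 x1 c0 c1 k l \<and>
        (\<exists>\<phi>. isometric_iso s G br B \<omega>
           (dext_scale s\<^sub>h) (dext_grading H) (dext_bracket s\<^sub>h H br\<^sub>h B\<^sub>h D Db x0 x1 k)
           (dext_form B\<^sub>h) (dext_omega s\<^sub>h B\<^sub>h \<delta> c0 c1 \<alpha> l) \<phi>))"

end

theory Submission
  imports Defs
begin

text \<open>
  Write \<open>\<omega>(x, y) = B(\<delta>(x), y)\<close>.  Non-degeneracy of both forms and the
  cocycle identity make \<open>\<delta>\<close> an invertible odd superderivation, skew for
  \<open>B\<close>, so \<open>\<delta>\<^sup>2\<close> is an invertible even derivation.

  An invertible even derivation forces a nonzero centre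
  (\<open>homogeneous_center_nontrivial\<close>).  The generalized eigenspaces of the derivation
  satisfy
  \<open>[\<gg>\<^sub>\<mu>, \<gg>\<^sub>\<nu>] \<subseteq> \<gg>\<^bsub>\<mu>+\<nu>\<^esub>\<close>
  with only finitely many weights, none of them zero, so in characteristic zero every weight vector
  acts nilpotently, and Engel's argument applies to the set of weight vectors, which is closed under
  brackets.

  The centre is stable under \<open>\<delta>\<close>, and \<open>\<delta>\<close> exchanges its even
  and odd parts.  Hence its even part contains an eigenvector \<open>e\<^sub>0\<^sup>*\<close> of
  \<open>\<delta>\<^sup>2\<close>, with eigenvalue \<open>\<lambda>\<^sup>2 \<noteq> 0\<close>
  (\<open>even_central_eigenvector_exists\<close>).  With
  \<open>e\<^sub>1\<^sup>* = \<lambda>\<^sup>-\<^sup>1 \<delta>(e\<^sub>0\<^sup>*)\<close> the plane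
  \<open>I = \<langle>e\<^sub>0\<^sup>*, e\<^sub>1\<^sup>*\<rangle>\<close> is a
  \<open>\<delta>\<close>-stable central ideal, and it is isotropic because \<open>\<delta>\<close>
  is skew.  Choose \<open>e\<^sub>0\<close>, \<open>e\<^sub>1\<close> dual to it, let
  \<open>\<hh>\<close> be the orthogonal complement of all four vectors, and let \<open>P\<close> be
  the orthogonal projection onto \<open>\<hh>\<close>.

  The space \<open>\<hh>\<close> is \<open>I\<^sup>\<bottom> / I\<close> in disguise.  It carries
  the bracket \<open>P [X, Y]\<close>, the restrictions of the forms and the derivation
  \<open>P \<circ> \<delta>\<close>.  All brackets lie in \<open>I\<^sup>\<bottom>\<close>, since
  \<open>I\<close> is central and \<open>B\<close> is invariant, and \<open>P\<close> changes
  elements of \<open>I\<^sup>\<bottom>\<close> only by elements of \<open>I\<close>.  Therefore an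
  identity between brackets remains true after inserting \<open>P\<close> everywhere.  With
  \<open>D = P \<circ> ad e\<^sub>0\<close>, \<open>D' = P \<circ> ad e\<^sub>1\<close>,
  \<open>x\<^sub>0 = P [e\<^sub>1, e\<^sub>1]\<close>,
  \<open>x\<^sub>1 = P [e\<^sub>0, e\<^sub>1]\<close>,
  \<open>c\<^sub>0 = P (\<delta> e\<^sub>1)\<close>,
  \<open>c\<^sub>1 = P (\<delta> e\<^sub>0)\<close>, the relations of a double extension are
  projections of Jacobi identities and of the derivation rule for \<open>\<delta>\<close>, except
  the scalar relations \<open>B(x\<^sub>0, x\<^sub>0) = 0\<close> and
  \<open>\<lambda> k = B(c\<^sub>0, x\<^sub>0)\<close>, which come from pairing such identities with
  \<open>e\<^sub>1\<close>.  The coefficients of a vector with respect to the four vectors, together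
  with its projection to \<open>\<hh>\<close>, give the isomorphism (\<open>coordinates\<close>);
  invariance of \<open>B\<close> and skewness of \<open>\<delta>\<close> identify the components of
  brackets and of \<open>\<delta>\<close> along \<open>e\<^sub>0\<^sup>*\<close> and
  \<open>e\<^sub>1\<^sup>*\<close>.
\<close>

section \<open>Generalized eigenvectors\<close>

locale endomorphism_on = vector_space scale
  for scale :: "'k::alg_closed_field \<Rightarrow> 'v::ab_group_add \<Rightarrow> 'v" +
  fixes V :: "'v set" and T :: "'v \<Rightarrow> 'v"
  assumes V_subspace: "subspace V"
    and V_finite: "\<exists>S. finite S \<and> V \<subseteq> span S"
    and T_linear: "linear_map_on scale scale V T"
    and T_stable: "x \<in> V \<Longrightarrow> T x \<in> V"

text \<open>
  Membership unfolds to \<open>(T - \<mu>)\<^sup>n v = 0\<close> for some \<open>n\<close>.  With an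
  inductive definition the closure properties below, in particular compatibility with brackets, are
  rule inductions and need no binomial expansion of powers of \<open>T - \<mu>\<close>.
\<close>
inductive_set generalized_eigenspace ::
  "('k \<Rightarrow> 'v \<Rightarrow> 'v::ab_group_add) \<Rightarrow> 'v set \<Rightarrow> ('v \<Rightarrow> 'v) \<Rightarrow> 'k \<Rightarrow> 'v set"
  for s V T \<mu> where
  zero: "0 \<in> generalized_eigenspace s V T \<mu>"
| step: "\<lbrakk>v \<in> V; T v - s \<mu> v \<in> generalized_eigenspace s V T \<mu>\<rbrakk>
    \<Longrightarrow> v \<in> generalized_eigenspace s V T \<mu>"

lemma generalized_eigenspace_mono:
  assumes "V \<subseteq> W" "v \<in> generalized_eigenspace s V T \<mu>"
  shows "v \<in> generalized_eigenspace s W T \<mu>"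
  using assms(2) by induction (use assms(1) in \<open>auto intro: generalized_eigenspace.intros\<close>)

text \<open>
  Horner evaluation of \<open>p(T) v\<close> for the polynomial \<open>p\<close> with the given
  coefficient list.
\<close>
primrec evaluate_at :: "('k \<Rightarrow> 'v \<Rightarrow> 'v::ab_group_add) \<Rightarrow> ('v \<Rightarrow> 'v) \<Rightarrow> 'k list \<Rightarrow> 'v \<Rightarrow> 'v" where
  "evaluate_at s T [] v = 0"
| "evaluate_at s T (a # as) v = s a v + T (evaluate_at s T as v)"

context vector_space
begin

lemma finite_dimensional_sequence_dependent:
  assumes "finite S" "\<And>n. u n \<in> span S"
  shows "\<exists>n::nat. u n \<in> span (u ` {..<n})"
proof (rule ccontr)
  assume "\<not> ?thesis"
  then have new: "u n \<notin> span (u ` {..<n})" for n by simp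
  have "independent (u ` {..<n}) \<and> card (u ` {..<n}) = n" for n
  proof (induction n)
    case (Suc n)
    have "u n \<notin> u ` {..<n}" using new[of n] by (rule contrapos_nn) (rule span_base)
    moreover have "independent (insert (u n) (u ` {..<n}))"
      using new[of n] Suc by (intro independent_insertI) simp_all
    ultimately show ?case using Suc by (simp only: lessThan_Suc image_insert) simp
  qed (simp add: independent_empty)
  moreover have "u ` {..<n} \<subseteq> span S" for n using assms(2) by blast
  ultimately have "n \<le> card S" for n
    using independent_span_bound[OF assms(1)] by metis
  then show False using Suc_n_not_le_n by blast
qed

end

context endomorphism_on
begin

lemma T_add [simp]: "\<lbrakk>x \<in> V; y \<in> V\<rbrakk> \<Longrightarrow> T (x + y) = T x + T y"
  and T_scale [simp]: "x \<in> V \<Longrightarrow> T (scale c x) = scale c (T x)"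
  using T_linear unfolding linear_map_on_def by blast+

lemma V_closed [simp, intro]:
  "0 \<in> V" "\<lbrakk>x \<in> V; y \<in> V\<rbrakk> \<Longrightarrow> x + y \<in> V" "\<lbrakk>x \<in> V; y \<in> V\<rbrakk> \<Longrightarrow> x - y \<in> V"
  "x \<in> V \<Longrightarrow> scale c x \<in> V" "x \<in> V \<Longrightarrow> T x \<in> V"
  using V_subspace T_stable by (auto simp: subspace_0 subspace_add subspace_diff subspace_scale)

lemma T_zero [simp]: "T 0 = 0"
  using T_scale[of 0 0] by simp

lemma T_diff [simp]: "\<lbrakk>x \<in> V; y \<in> V\<rbrakk> \<Longrightarrow> T (x - y) = T x - T y"
  using T_add[of "x - y" y] by simp

abbreviation poly_at :: "'k poly \<Rightarrow> 'v \<Rightarrow> 'v" where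
  "poly_at p \<equiv> evaluate_at scale T (coeffs p)"

lemma poly_at_pCons [simp]: "poly_at (pCons a p) v = scale a v + T (poly_at p v)"
  by (cases "a = 0 \<and> p = 0") (auto simp: cCons_def)

lemma poly_at_mem [simp]: "v \<in> V \<Longrightarrow> poly_at p v \<in> V"
  by (induction p) auto

lemma poly_at_add [simp]: "v \<in> V \<Longrightarrow> poly_at (p + q) v = poly_at p v + poly_at q v"
  by (induction p q rule: poly_induct2) (auto simp: scale_left_distrib simp del: coeffs_pCons_eq_cCons)

lemma poly_at_smult [simp]: "v \<in> V \<Longrightarrow> poly_at (smult c p) v = scale c (poly_at p v)"
  by (induction p) (auto simp: scale_right_distrib simp del: coeffs_pCons_eq_cCons)

lemma poly_at_diff [simp]:
  assumes "v \<in> V" shows "poly_at (p - q) v = poly_at p v - poly_at q v"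
proof -
  have "poly_at (p - q) v = poly_at (p + smult (-1) q) v" by simp
  also have "\<dots> = poly_at p v - poly_at q v"
    using assms by (simp only: poly_at_add poly_at_smult) simp
  finally show ?thesis .
qed

lemma annihilating_poly_exists:
  assumes "v \<in> V"
  shows "\<exists>p. p \<noteq> 0 \<and> poly_at p v = 0"
proof -
  have mem: "(T ^^ n) v \<in> V" for n by (induction n) (auto simp: assms)
  obtain S where S: "finite S" "V \<subseteq> span S" using V_finite by blast
  then obtain n where n: "(T ^^ n) v \<in> span ((\<lambda>i. (T ^^ i) v) ` {..<n})"
    using finite_dimensional_sequence_dependent[of S "\<lambda>n. (T ^^ n) v"] mem by blast
  have monom: "poly_at (monom 1 i) v = (T ^^ i) v" for i
    by (induction i) (auto simp: monom_Suc monom_0 simp del: coeffs_pCons_eq_cCons)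
  define R where "R = {poly_at p v | p. \<forall>i\<ge>n. coeff p i = 0}"
  have "subspace R"
    unfolding subspace_def
  proof (intro conjI ballI allI)
    show "0 \<in> R" unfolding R_def by (auto intro!: exI[of _ 0])
  next
    fix x y assume "x \<in> R" "y \<in> R"
    then obtain p q where "x = poly_at p v" "y = poly_at q v"
        "\<forall>i\<ge>n. coeff p i = 0" "\<forall>i\<ge>n. coeff q i = 0"
      unfolding R_def by blast
    then show "x + y \<in> R" unfolding R_def by (auto intro!: exI[of _ "p + q"] simp: assms)
  next
    fix c x assume "x \<in> R"
    then obtain p where "x = poly_at p v" "\<forall>i\<ge>n. coeff p i = 0"
      unfolding R_def by blast
    then show "scale c x \<in> R" unfolding R_def by (auto intro!: exI[of _ "smult c p"] simp: assms)
  qed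
  moreover have "(\<lambda>i. (T ^^ i) v) ` {..<n} \<subseteq> R"
  proof (rule image_subsetI)
    fix i assume "i \<in> {..<n}"
    then show "(T ^^ i) v \<in> R"
      unfolding R_def using monom[of i] by (auto intro!: exI[of _ "monom 1 i"])
  qed
  ultimately have "(T ^^ n) v \<in> R" using n span_minimal[of _ R] by blast
  then obtain q where q: "(T ^^ n) v = poly_at q v" "\<forall>i\<ge>n. coeff q i = 0"
    unfolding R_def by blast
  have "coeff (monom 1 n - q) n = 1" using q by simp
  then have "monom 1 n - q \<noteq> 0" by auto
  moreover have "poly_at (monom 1 n - q) v = 0"
    using q(1) monom[of n] by (simp only: poly_at_diff[OF assms] right_minus_eq)
  ultimately show ?thesis by (intro exI[of _ "monom 1 n - q"] conjI)
qed

text \<open>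
  An eigenvector of \<open>T\<close> on \<open>V / U\<close>, phrased without the quotient: for a
  nonzero polynomial \<open>p\<close> of least degree with \<open>p(T) v \<in> U\<close>, split off
  a linear factor, \<open>p = (X - \<mu>) q\<close>, and take \<open>w = q(T) v\<close>, which is
  not in \<open>U\<close> by minimality.
\<close>
lemma relative_eigenvector_exists:
  assumes "subspace U" "v \<in> V" "v \<notin> U"
  shows "\<exists>w \<mu>. w \<in> V \<and> w \<notin> U \<and> T w - scale \<mu> w \<in> U"
proof -
  define P where "P p \<longleftrightarrow> p \<noteq> 0 \<and> poly_at p v \<in> U" for p
  obtain p' where "p' \<noteq> 0" "poly_at p' v = 0"
    using annihilating_poly_exists[OF assms(2)] by blast
  then have "P p'" using subspace_0[OF assms(1)] unfolding P_def by simp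
  then obtain p where p: "P p" and least: "\<And>q. P q \<Longrightarrow> degree p \<le> degree q"
    using ex_has_least_nat[of P p' degree] by blast
  have "degree p > 0"
  proof (rule ccontr)
    assume "\<not> degree p > 0"
    then obtain c where "p = [:c:]" using degree_eq_zeroE[of p] by auto
    with p have "c \<noteq> 0" "scale c v \<in> U" unfolding P_def by (auto simp: cCons_def)
    then have "scale (inverse c) (scale c v) \<in> U" using assms(1) subspace_scale by blast
    with \<open>c \<noteq> 0\<close> assms(3) show False by simp
  qed
  then obtain \<mu> where "poly p \<mu> = 0" using alg_closed_imp_poly_has_root by blast
  then obtain q where q: "p = [:- \<mu>, 1:] * q" unfolding poly_eq_0_iff_dvd by (elim dvdE)
  have "q \<noteq> 0" using p q unfolding P_def by auto
  then have "degree p = Suc (degree q)" unfolding q by (subst degree_mult_eq) auto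
  then have "poly_at q v \<notin> U" using least[of q] \<open>q \<noteq> 0\<close> unfolding P_def by auto
  moreover have "p = pCons 0 q - smult \<mu> q" using q by simp
  then have "poly_at p v = T (poly_at q v) - scale \<mu> (poly_at q v)"
    using assms(2) by (simp del: coeffs_pCons_eq_cCons)
  then have "T (poly_at q v) - scale \<mu> (poly_at q v) \<in> U" using p unfolding P_def by simp
  ultimately show ?thesis using assms(2) poly_at_mem by blast
qed

abbreviation gen :: "'k \<Rightarrow> 'v set" where
  "gen \<mu> \<equiv> generalized_eigenspace scale V T \<mu>"

lemma gen_subset: "v \<in> gen \<mu> \<Longrightarrow> v \<in> V"
  by (induction rule: generalized_eigenspace.induct) auto

lemma genI: "\<lbrakk>v \<in> V; T v - scale \<mu> v = w; w \<in> gen \<mu>\<rbrakk> \<Longrightarrow> v \<in> gen \<mu>"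
  by (rule generalized_eigenspace.step) simp_all

lemma gen_add:
  assumes "x \<in> gen \<mu>" "y \<in> gen \<mu>" shows "x + y \<in> gen \<mu>"
  using assms
proof (induction arbitrary: y rule: generalized_eigenspace.induct)
  case (step v)
  from step.prems show ?case
  proof cases
    case zero
    show ?thesis unfolding zero using step.hyps by (auto intro: generalized_eigenspace.step)
  next
    case y: step
    show ?thesis
    proof (rule genI)
      show "T (v + y) - scale \<mu> (v + y) = (T v - scale \<mu> v) + (T y - scale \<mu> y)"
        using step.hyps y by (simp add: algebra_simps)
      show "(T v - scale \<mu> v) + (T y - scale \<mu> y) \<in> gen \<mu>" by (rule step.IH[OF y(2)])
    qed (use step.hyps y in auto)
  qed
qed simp

lemma gen_scale:
  assumes "x \<in> gen \<mu>" shows "scale c x \<in> gen \<mu>"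
  using assms
proof (induction rule: generalized_eigenspace.induct)
  case (step v)
  show ?case
  proof (rule genI)
    show "T (scale c v) - scale \<mu> (scale c v) = scale c (T v - scale \<mu> v)"
      using step by (simp add: scale_right_diff_distrib mult.commute)
  qed (use step in auto)
qed (simp add: generalized_eigenspace.zero)

text \<open>
  On the generalized eigenspace of \<open>\<nu>\<close> the operator
  \<open>T - \<mu> = (T - \<nu>) + (\<nu> - \<mu>)\<close> is a nilpotent perturbation of a nonzero
  scalar.  If \<open>u\<close> solves the equation for \<open>(T - \<nu>) w\<close>, then
  \<open>(w - u) / (\<nu> - \<mu>)\<close> solves it for \<open>w\<close>.
\<close>
lemma gen_shift_surjective:
  assumes "x \<in> gen \<nu>" "\<mu> \<noteq> \<nu>"
  shows "\<exists>y\<in>gen \<nu>. T y - scale \<mu> y = x"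
  using assms(1)
proof (induction rule: generalized_eigenspace.induct)
  case zero
  show ?case by (rule bexI[of _ 0]) (auto intro: generalized_eigenspace.zero)
next
  case (step w)
  then obtain u where u: "u \<in> gen \<nu>" "T u - scale \<mu> u = T w - scale \<nu> w" by blast
  have w: "w \<in> gen \<nu>" using step.hyps by (rule generalized_eigenspace.step)
  define y where "y = scale (inverse (\<nu> - \<mu>)) (w - u)"
  have mem: "w \<in> V" "u \<in> V" using u w gen_subset by auto
  have "scale (inverse (\<nu> - \<mu>)) (w + scale (-1) u) \<in> gen \<nu>"
    by (intro gen_scale gen_add w u(1))
  then have "y \<in> gen \<nu>" unfolding y_def by simp
  moreover have "T y - scale \<mu> y = w"
  proof -
    have "T y - scale \<mu> y = scale (inverse (\<nu> - \<mu>)) ((T w - scale \<mu> w) - (T u - scale \<mu> u))"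
      unfolding y_def using mem
      by (simp add: scale_right_diff_distrib algebra_simps)
    also have "(T w - scale \<mu> w) - (T u - scale \<mu> u) = scale (\<nu> - \<mu>) w"
      unfolding u(2) by (simp add: scale_left_diff_distrib)
    finally show ?thesis using assms(2) by simp
  qed
  ultimately show ?case by blast
qed

text \<open>
  Let \<open>U\<close> be the span.  On \<open>U\<close> the operator \<open>T - \<mu>\<close> is
  surjective modulo the generalized eigenspace of \<open>\<mu>\<close>.  Hence an eigenvector
  \<open>w\<close> of eigenvalue \<open>\<mu>\<close> modulo \<open>U\<close> can be corrected by
  some \<open>y \<in> U\<close> to a generalized eigenvector, so it lies in \<open>U\<close>
  already.
\<close>
lemma generalized_eigenvectors_span: "V \<subseteq> span (\<Union>\<mu>. gen \<mu>)"
proof (rule ccontr)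
  let ?U = "span (\<Union>\<mu>. gen \<mu>)"
  assume "\<not> ?thesis"
  then obtain w \<mu> where w: "w \<in> V" "w \<notin> ?U" "T w - scale \<mu> w \<in> ?U"
    using relative_eigenvector_exists[OF subspace_span] by blast
  have "x \<in> ?U \<Longrightarrow> \<exists>y\<in>?U. y \<in> V \<and> (T y - scale \<mu> y) - x \<in> gen \<mu>" for x
  proof (induction rule: span_induct_alt)
    case base
    show ?case by (rule bexI[of _ 0]) (auto intro: generalized_eigenspace.zero span_zero)
  next
    case (step c x z)
    then obtain \<nu> where x: "x \<in> gen \<nu>" by blast
    obtain y where y: "y \<in> ?U" "y \<in> V" "(T y - scale \<mu> y) - z \<in> gen \<mu>"
      using step by blast
    have "\<exists>u\<in>?U. u \<in> V \<and> (T u - scale \<mu> u) - x \<in> gen \<mu>"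
    proof (cases "\<nu> = \<mu>")
      case True
      have "- x \<in> gen \<mu>" using gen_scale[OF x, of "-1"] True by simp
      then show ?thesis by (intro bexI[of _ 0]) (auto simp: span_zero)
    next
      case False
      then obtain u where "u \<in> gen \<nu>" "T u - scale \<mu> u = x"
        using gen_shift_surjective[OF x, of \<mu>] by auto
      then show ?thesis
        by (intro bexI[of _ u]) (auto simp: generalized_eigenspace.zero gen_subset intro!: span_base)
    qed
    then obtain u where u: "u \<in> ?U" "u \<in> V" "(T u - scale \<mu> u) - x \<in> gen \<mu>" by blast
    have "(T (scale c u + y) - scale \<mu> (scale c u + y)) - (scale c x + z)
        = scale c ((T u - scale \<mu> u) - x) + ((T y - scale \<mu> y) - z)"
      using u y by (simp add: algebra_simps)
    also have "\<dots> \<in> gen \<mu>" using u y by (intro gen_add gen_scale)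
    finally have "(T (scale c u + y) - scale \<mu> (scale c u + y)) - (scale c x + z) \<in> gen \<mu>" .
    then show ?case using u y by (intro bexI[of _ "scale c u + y"]) (auto intro: span_add span_scale)
  qed
  from this[OF w(3)] obtain y where
    y: "y \<in> ?U" "y \<in> V" "(T y - scale \<mu> y) - (T w - scale \<mu> w) \<in> gen \<mu>" by blast
  have "y - w \<in> gen \<mu>"
  proof (rule genI)
    show "T (y - w) - scale \<mu> (y - w) = (T y - scale \<mu> y) - (T w - scale \<mu> w)"
      using y w by (simp add: algebra_simps)
  qed (use y w in auto)
  then have "y - w \<in> ?U" by (auto intro: span_base)
  then have "y - (y - w) \<in> ?U" using y(1) span_diff by blast
  then show False using w by simp
qed

lemma eigenvector_in_gen:
  assumes "v \<in> gen \<mu>" "v \<noteq> 0"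
  shows "\<exists>u\<in>V. u \<noteq> 0 \<and> T u = scale \<mu> u"
  using assms by (induction rule: generalized_eigenspace.induct) auto

text \<open>
  Linear independence of eigenvectors with distinct eigenvalues, in a form that is its own induction
  hypothesis: \<open>u n\<close> is not in the span of its predecessors by the case
  \<open>x = u n\<close>.
\<close>
lemma eigenvectors_of_distinct_eigenvalues:
  fixes n :: nat
  assumes "\<And>i. u i \<in> V" "\<And>i. u i \<noteq> 0" "\<And>i. T (u i) = scale (\<mu> i) (u i)" "inj \<mu>"
    and "x \<in> span (u ` {..<n})" "T x = scale \<nu> x" "\<nu> \<notin> \<mu> ` {..<n}"
  shows "x = 0"
  using assms(5-)
proof (induction n arbitrary: x \<nu>)
  case (Suc n)
  let ?U = "span (u ` {..<n})"
  have UV: "?U \<subseteq> V" using assms(1) V_subspace by (intro span_minimal) auto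
  have "?U \<subseteq> {y \<in> V. T y \<in> ?U}"
  proof (rule span_minimal)
    show "u ` {..<n} \<subseteq> {y \<in> V. T y \<in> ?U}"
      using assms(1,3) by (auto intro!: span_scale[OF span_base])
    show "subspace {y \<in> V. T y \<in> ?U}"
      unfolding subspace_def by (auto intro: span_zero span_add span_scale)
  qed
  then have U_stable: "T y \<in> ?U" if "y \<in> ?U" for y using that by blast
  obtain c where c: "x - scale c (u n) \<in> ?U"
    using Suc.prems(1) unfolding lessThan_Suc image_insert span_breakdown_eq by blast
  define y where "y = x - scale c (u n)"
  have y: "y \<in> ?U" "y \<in> V" "x = y + scale c (u n)" using c UV unfolding y_def by auto
  have "T y - scale \<nu> y + scale (c * (\<mu> n - \<nu>)) (u n) = T x - scale \<nu> x"
    unfolding y(3) using y(2) assms(1,3) by (simp add: algebra_simps)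
  also have "\<dots> = 0" using Suc.prems(2) by simp
  finally have "scale (c * (\<mu> n - \<nu>)) (u n) = - (T y - scale \<nu> y)"
    unfolding eq_neg_iff_add_eq_0 by (simp only: add.commute)
  also have "\<dots> \<in> ?U" using y(1) U_stable by (intro span_neg span_diff span_scale)
  finally have "scale (c * (\<mu> n - \<nu>)) (u n) \<in> ?U" .
  moreover have "u n \<notin> ?U"
    using Suc.IH[of "u n" "\<mu> n"] assms(2-4) by (auto simp: inj_def)
  moreover have "u n \<in> ?U" if "d \<noteq> 0" "scale d (u n) \<in> ?U" for d
    using span_scale[OF that(2), of "inverse d"] that(1) by simp
  ultimately have "c * (\<mu> n - \<nu>) = 0" by blast
  moreover have "\<mu> n \<noteq> \<nu>" using Suc.prems(3) by auto
  ultimately have "c = 0" by simp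
  then show ?case using Suc y by (auto simp: lessThan_Suc)
qed simp

text \<open>
  The finiteness of the spectrum, in the form in which it yields nilpotency: vectors whose weights
  run through infinitely many values cannot all be nonzero.
\<close>
lemma no_infinite_sequence_of_weights:
  fixes \<mu> :: "nat \<Rightarrow> 'k"
  assumes "inj \<mu>" "\<And>n. v n \<in> gen (\<mu> n)"
  shows "\<exists>n. v n = 0"
proof (rule ccontr)
  assume "\<not> ?thesis"
  then have "\<forall>n. \<exists>u\<in>V. u \<noteq> 0 \<and> T u = scale (\<mu> n) u"
    using eigenvector_in_gen assms(2) by blast
  then obtain u where u: "\<And>n. u n \<in> V" "\<And>n. u n \<noteq> 0" "\<And>n. T (u n) = scale (\<mu> n) (u n)"
    by metis
  obtain S where "finite S" "V \<subseteq> span S" using V_finite by blast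
  then obtain n where "u n \<in> span (u ` {..<n})"
    using finite_dimensional_sequence_dependent[of S u] u(1) by blast
  moreover have "\<mu> n \<notin> \<mu> ` {..<n}" using assms(1) by (auto simp: inj_def)
  ultimately show False
    using eigenvectors_of_distinct_eigenvalues[OF u assms(1)] u by blast
qed

end

section \<open>Superspaces and Lie superalgebras\<close>

lemma ksign_simps [simp]: "ksign 0 b = 1" "ksign a 0 = 1" "ksign 1 1 = - 1"
  by (simp_all add: ksign_def)

lemma eq_neg_self_imp_zero:
  fixes x :: "'v::ab_group_add" and scale :: "'k::field_char_0 \<Rightarrow> 'v \<Rightarrow> 'v"
  assumes "vector_space scale" "x = - x"
  shows "x = 0"
proof -
  interpret vector_space scale by fact
  have "scale 2 x = x + x" using scale_left_distrib[of 1 1 x] by simp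
  also have "\<dots> = 0" using assms(2) by (simp add: eq_neg_iff_add_eq_0)
  finally show ?thesis by simp
qed

context superspace
begin

abbreviation C :: "'v set" where "C \<equiv> super_carrier G"

lemma component_closed [simp, intro]:
  "0 \<in> G a" "\<lbrakk>x \<in> G a; y \<in> G a\<rbrakk> \<Longrightarrow> x + y \<in> G a" "\<lbrakk>x \<in> G a; y \<in> G a\<rbrakk> \<Longrightarrow> x - y \<in> G a"
  "x \<in> G a \<Longrightarrow> scale c x \<in> G a" "x \<in> G a \<Longrightarrow> - x \<in> G a"
  using subspace_component[of a]
  by (auto simp: subspace_0 subspace_add subspace_diff subspace_scale subspace_neg)

lemma component_subset [simp, intro]:
  assumes "x \<in> G a" shows "x \<in> C"
proof (cases "a = 0")
  case True
  then show ?thesis using assms unfolding super_carrier_def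
    by (intro CollectI exI[of _ x] exI[of _ 0]) auto
next
  case False
  then have "a = 1" by simp
  then show ?thesis using assms unfolding super_carrier_def
    by (intro CollectI exI[of _ 0] exI[of _ x]) auto
qed

lemma carrierE:
  assumes "x \<in> C"
  obtains u v where "u \<in> G 0" "v \<in> G 1" "x = u + v"
  using assms unfolding super_carrier_def by blast

lemma carrier_subspace: "subspace C"
  unfolding super_carrier_def by (intro subspace_sums subspace_component)

lemma carrier_closed [simp, intro]:
  "0 \<in> C" "\<lbrakk>x \<in> C; y \<in> C\<rbrakk> \<Longrightarrow> x + y \<in> C" "\<lbrakk>x \<in> C; y \<in> C\<rbrakk> \<Longrightarrow> x - y \<in> C"
  "x \<in> C \<Longrightarrow> scale c x \<in> C" "x \<in> C \<Longrightarrow> - x \<in> C"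
  using carrier_subspace
  by (auto simp: subspace_0 subspace_add subspace_diff subspace_scale subspace_neg)

lemma carrier_finite: "\<exists>S. finite S \<and> C \<subseteq> span S"
  using finite_dimensional by blast

end

context lie_superalgebra
begin

lemma br_mem [simp, intro]:
  assumes "x \<in> C" "y \<in> C" shows "br x y \<in> C"
proof -
  have add: "br u (v + w) = br u v + br u w" if "u \<in> C" "v \<in> C" "w \<in> C" for u v w
    using br_bilinear that unfolding bilinear_map_on_def linear_map_on_def by blast
  have add': "br (v + w) u = br v u + br w u" if "u \<in> C" "v \<in> C" "w \<in> C" for u v w
    using br_bilinear that unfolding bilinear_map_on_def linear_map_on_def by blast
  have hom: "br u v \<in> C" if "u \<in> G a" "v \<in> G b" for u v a b
    using br_graded that by blast
  obtain x0 x1 where x: "x0 \<in> G 0" "x1 \<in> G 1" "x = x0 + x1" using assms(1) by (rule carrierE)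
  obtain y0 y1 where y: "y0 \<in> G 0" "y1 \<in> G 1" "y = y0 + y1" using assms(2) by (rule carrierE)
  show ?thesis
    unfolding x(3) y(3) using x(1,2) y(1,2) by (auto simp: add add' intro!: hom)
qed

lemma br_add_right [simp]: "\<lbrakk>x \<in> C; y \<in> C; z \<in> C\<rbrakk> \<Longrightarrow> br x (y + z) = br x y + br x z"
  and br_add_left [simp]: "\<lbrakk>x \<in> C; y \<in> C; z \<in> C\<rbrakk> \<Longrightarrow> br (x + y) z = br x z + br y z"
  and br_scale_right [simp]: "\<lbrakk>x \<in> C; y \<in> C\<rbrakk> \<Longrightarrow> br x (scale c y) = scale c (br x y)"
  and br_scale_left [simp]: "\<lbrakk>x \<in> C; y \<in> C\<rbrakk> \<Longrightarrow> br (scale c x) y = scale c (br x y)"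
  using br_bilinear unfolding bilinear_map_on_def linear_map_on_def by blast+

lemma br_zero [simp]: "x \<in> C \<Longrightarrow> br x 0 = 0" "x \<in> C \<Longrightarrow> br 0 x = 0"
  using br_scale_right[of x 0 0] br_scale_left[of 0 x 0] by auto

lemma br_diff_right [simp]: "\<lbrakk>x \<in> C; y \<in> C; z \<in> C\<rbrakk> \<Longrightarrow> br x (y - z) = br x y - br x z"
  and br_diff_left [simp]: "\<lbrakk>x \<in> C; y \<in> C; z \<in> C\<rbrakk> \<Longrightarrow> br (x - y) z = br x z - br y z"
  using br_add_right[of x "y - z" z] br_add_left[of "x - y" y z] by auto

lemma br_minus_right [simp]: "\<lbrakk>x \<in> C; y \<in> C\<rbrakk> \<Longrightarrow> br x (- y) = - br x y"
  and br_minus_left [simp]: "\<lbrakk>x \<in> C; y \<in> C\<rbrakk> \<Longrightarrow> br (- x) y = - br x y"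
  using br_diff_right[of x 0 y] br_diff_left[of 0 x y] by auto

text \<open>
  The Jacobi identity says that \<open>[x, -]\<close> is a superderivation; the later computations
  use it in this form.
\<close>
lemma br_leibniz_homogeneous:
  assumes "x \<in> G a" "y \<in> G b" "z \<in> G c"
  shows "br x (br y z) = br (br x y) z + scale (ksign a b) (br y (br x z))"
proof -
  have xz: "br z x = - scale (ksign c a) (br x z)"
    by (rule br_skew[OF assms(3,1)])
  have zxy: "br z (br x y) = - scale (ksign c (a + b)) (br (br x y) z)"
    by (rule br_skew[OF assms(3) br_graded[OF assms(1,2)]])
  have J: "scale (ksign a c) (br x (br y z)) + scale (ksign a b) (br y (br z x))
      + scale (ksign b c) (br z (br x y)) = 0"
    by (rule br_jacobi[OF assms])
  show ?thesis
    using J unfolding xz zxy using assms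
    by (cases a; cases b; cases c) (simp_all add: algebra_simps)
qed

lemma br_leibniz:
  assumes "x \<in> G a" "y \<in> G b" "z \<in> C"
  shows "br x (br y z) = br (br x y) z + scale (ksign a b) (br y (br x z))"
proof -
  obtain u v where z: "u \<in> G 0" "v \<in> G 1" "z = u + v" using assms(3) by (rule carrierE)
  have "br x (br y z) = br x (br y u) + br x (br y v)"
    using assms z by simp
  then show ?thesis
    unfolding br_leibniz_homogeneous[OF assms(1,2) z(1)] br_leibniz_homogeneous[OF assms(1,2) z(2)]
    using assms z by (simp add: scale_right_distrib)
qed

end

section \<open>The centre of a Lie superalgebra with an invertible even derivation\<close>

text \<open>
  This is the super version of Jacobson's theorem that a Lie algebra with an invertible derivation
  is nilpotent, reduced to the existence of a nonzero central element.  All weights of the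
  derivation \<open>T\<close> are nonzero, so the adjoint action of a weight vector moves weights by
  a nonzero amount and is nilpotent.  As brackets of weight vectors are weight vectors, Engel's
  argument applies to them.
\<close>
locale lie_superalgebra_with_invertible_derivation = lie_superalgebra scale G br
  for scale :: "'k::{alg_closed_field, field_char_0} \<Rightarrow> 'v::ab_group_add \<Rightarrow> 'v"
    and G :: "bit \<Rightarrow> 'v set" and br :: "'v \<Rightarrow> 'v \<Rightarrow> 'v" +
  fixes T :: "'v \<Rightarrow> 'v"
  assumes T_lin: "linear_map_on scale scale (super_carrier G) T"
    and T_even: "x \<in> G a \<Longrightarrow> T x \<in> G a"
    and T_derivation: "\<lbrakk>x \<in> super_carrier G; y \<in> super_carrier G\<rbrakk> \<Longrightarrow> T (br x y) = br (T x) y + br x (T y)"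
    and T_injective: "\<lbrakk>x \<in> super_carrier G; T x = 0\<rbrakk> \<Longrightarrow> x = 0"
begin

sublocale T: endomorphism_on scale C T
proof
  show "T x \<in> C" if xC: "x \<in> C" for x
  proof -
    obtain u v where x: "u \<in> G 0" "v \<in> G 1" "x = u + v" using xC by (rule carrierE)
    then have "T x = T u + T v" using T_lin unfolding linear_map_on_def by auto
    then show ?thesis using x T_even by auto
  qed
qed (rule carrier_subspace carrier_finite T_lin)+

lemma T_component: "endomorphism_on scale (G a) T"
proof
  show "linear_map_on scale scale (G a) T"
    using T_lin unfolding linear_map_on_def by (meson component_subset)
  show "\<exists>S. finite S \<and> G a \<subseteq> span S" using carrier_finite by blast
qed (auto intro: subspace_component T_even)

lemma gen_zero: "x \<in> T.gen 0 \<Longrightarrow> x = 0"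
  by (induction rule: generalized_eigenspace.induct) (auto simp: T_injective)

lemma br_gen:
  assumes "x \<in> T.gen \<mu>" "y \<in> T.gen \<nu>" shows "br x y \<in> T.gen (\<mu> + \<nu>)"
  using assms
proof (induction arbitrary: y rule: generalized_eigenspace.induct)
  case zero
  then show ?case using T.gen_subset by (auto intro: generalized_eigenspace.zero)
next
  case x: (step x)
  from x.prems show ?case
  proof (induction rule: generalized_eigenspace.induct)
    case zero
    then show ?case using x.hyps by (auto intro: generalized_eigenspace.zero)
  next
    case y: (step y)
    have "y \<in> T.gen \<nu>" using y.hyps by (rule generalized_eigenspace.step)
    show ?case
    proof (rule T.genI)
      show "T (br x y) - scale (\<mu> + \<nu>) (br x y)
          = br (T x - scale \<mu> x) y + br x (T y - scale \<nu> y)"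
        using x.hyps y.hyps by (simp add: T_derivation algebra_simps)
      show "br (T x - scale \<mu> x) y + br x (T y - scale \<nu> y) \<in> T.gen (\<mu> + \<nu>)"
        using x.IH[OF \<open>y \<in> T.gen \<nu>\<close>] y.IH by (rule T.gen_add)
    qed (use x.hyps y.hyps in auto)
  qed
qed

definition weight_vectors :: "'v set" where
  "weight_vectors = {x. (\<exists>a. x \<in> G a) \<and> (\<exists>\<mu>. x \<in> T.gen \<mu>)}"

lemma weight_vectors_subset: "weight_vectors \<subseteq> C"
  unfolding weight_vectors_def by auto

lemma weight_vectors_span: "C \<subseteq> span weight_vectors"
proof -
  have "G a \<subseteq> span weight_vectors" for a
  proof -
    interpret Ta: endomorphism_on scale "G a" T by (rule T_component)
    have "(\<Union>\<mu>. Ta.gen \<mu>) \<subseteq> weight_vectors"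
    proof clarify
      fix x \<mu> assume x: "x \<in> Ta.gen \<mu>"
      have "G a \<subseteq> C" by blast
      then have "x \<in> T.gen \<mu>" using x by (rule generalized_eigenspace_mono)
      then show "x \<in> weight_vectors"
        using Ta.gen_subset[OF x] unfolding weight_vectors_def by blast
    qed
    then show ?thesis using Ta.generalized_eigenvectors_span span_mono by blast
  qed
  then show ?thesis unfolding super_carrier_def by (auto intro!: span_add)
qed

lemma br_weight_vectors:
  assumes "x \<in> weight_vectors" "y \<in> weight_vectors" shows "br x y \<in> weight_vectors"
  using assms br_graded br_gen unfolding weight_vectors_def by blast

text \<open>
  If \<open>y\<close> has weight \<open>\<mu> \<noteq> 0\<close> and \<open>v\<close> has weight
  \<open>\<nu>\<close>, then \<open>(ad y)\<^sup>n v\<close> has weight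
  \<open>n \<mu> + \<nu>\<close>, and these weights are pairwise distinct in characteristic zero.
\<close>
lemma ad_weight_vector_nilpotent:
  assumes "y \<in> weight_vectors" "v \<in> weight_vectors"
  shows "\<exists>n. (br y ^^ n) v = 0"
proof (cases "y = 0")
  case True
  then have "(br y ^^ 1) v = 0" using assms weight_vectors_subset by auto
  then show ?thesis by blast
next
  case False
  obtain \<mu> \<nu> where \<mu>: "y \<in> T.gen \<mu>" and \<nu>: "v \<in> T.gen \<nu>"
    using assms unfolding weight_vectors_def by blast
  have "\<mu> \<noteq> 0" using False gen_zero \<mu> by blast
  then have "inj (\<lambda>n. of_nat n * \<mu> + \<nu>)" by (auto simp: inj_def)
  moreover have "(br y ^^ n) v \<in> T.gen (of_nat n * \<mu> + \<nu>)" for n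
  proof (induction n)
    case (Suc n)
    then show ?case using br_gen[OF \<mu>, of "(br y ^^ n) v" "of_nat n * \<mu> + \<nu>"]
      by (simp add: algebra_simps)
  qed (simp add: \<nu>)
  ultimately show ?thesis by (rule T.no_infinite_sequence_of_weights)
qed

text \<open>
  The conclusion of Engel's theorem for the adjoint action of \<open>F\<close> on the module spanned
  by \<open>M\<close> modulo \<open>W\<close>: some element outside \<open>W\<close> is annihilated
  modulo \<open>W\<close>.  Working relative to \<open>W\<close> avoids quotient modules, and a set
  \<open>M\<close> of weight vectors in place of its span ensures that the annihilated element is
  again a weight vector, hence acts nilpotently.  The choice \<open>W = span F\<close> serves to
  enlarge \<open>F\<close>, the choice \<open>W = {0}\<close> gives central elements.
\<close>
definition engel_property :: "'v set \<Rightarrow> bool" where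
  "engel_property F \<longleftrightarrow> (\<forall>M W. M \<subseteq> weight_vectors \<longrightarrow> subspace W \<longrightarrow> W \<subseteq> C \<longrightarrow> \<not> M \<subseteq> W \<longrightarrow>
     (\<forall>f\<in>F. \<forall>m\<in>M. br f m \<in> M) \<longrightarrow> (\<forall>f\<in>F. \<forall>w\<in>W. br f w \<in> W) \<longrightarrow>
     (\<exists>v\<in>M - W. \<forall>f\<in>F. br f v \<in> W))"

lemma engel_propertyD:
  assumes "engel_property F" "M \<subseteq> weight_vectors" "subspace W" "W \<subseteq> C" "\<not> M \<subseteq> W"
    and "\<And>f m. f \<in> F \<Longrightarrow> m \<in> M \<Longrightarrow> br f m \<in> M" "\<And>f w. f \<in> F \<Longrightarrow> w \<in> W \<Longrightarrow> br f w \<in> W"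
  shows "\<exists>v\<in>M - W. \<forall>f\<in>F. br f v \<in> W"
  using assms(1)[unfolded engel_property_def, THEN spec[of _ M], THEN spec[of _ W]] assms(2-) by simp

lemma br_span_left:
  assumes "F \<subseteq> C" "subspace W" "v \<in> C" "\<And>f. f \<in> F \<Longrightarrow> br f v \<in> W" "x \<in> span F"
  shows "br x v \<in> W"
proof -
  have "span F \<subseteq> {x \<in> C. br x v \<in> W}"
  proof (rule span_minimal)
    show "subspace {x \<in> C. br x v \<in> W}"
      unfolding subspace_def using assms(2,3) by (auto simp: subspace_0 subspace_add subspace_scale)
  qed (use assms in auto)
  then show ?thesis using assms(5) by blast
qed

lemma br_span_right:
  assumes "F \<subseteq> C" "subspace W" "v \<in> C" "\<And>f. f \<in> F \<Longrightarrow> br v f \<in> W" "x \<in> span F"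
  shows "br v x \<in> W"
proof -
  have "span F \<subseteq> {x \<in> C. br v x \<in> W}"
  proof (rule span_minimal)
    show "subspace {x \<in> C. br v x \<in> W}"
      unfolding subspace_def using assms(2,3) by (auto simp: subspace_0 subspace_add subspace_scale)
  qed (use assms in auto)
  then show ?thesis using assms(5) by blast
qed

text \<open>
  Let \<open>N\<close> consist of the elements of \<open>M\<close> that \<open>F\<close> annihilates
  modulo \<open>W\<close>.  As \<open>y\<close> normalizes \<open>span F\<close>, it preserves
  \<open>N\<close>; as \<open>ad y\<close> is nilpotent, the last element outside \<open>W\<close>
  of the sequence \<open>v, [y, v], [y, [y, v]], \<dots>\<close> is annihilated by \<open>y\<close>
  as well.
\<close>
lemma engel_extend:
  assumes F: "F \<subseteq> weight_vectors" "engel_property F"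
    and y: "y \<in> weight_vectors" "\<And>f. f \<in> F \<Longrightarrow> br f y \<in> span F"
  shows "engel_property (insert y F)"
  unfolding engel_property_def
proof (intro allI impI)
  fix M W
  assume M: "M \<subseteq> weight_vectors" and W: "subspace W" "W \<subseteq> C" and MW: "\<not> M \<subseteq> W"
    and FM: "\<forall>f\<in>insert y F. \<forall>m\<in>M. br f m \<in> M" and FW: "\<forall>f\<in>insert y F. \<forall>w\<in>W. br f w \<in> W"
  have sub: "F \<subseteq> C" "M \<subseteq> C" "y \<in> C" using F M y weight_vectors_subset by auto
  define N where "N = {v \<in> M. \<forall>f\<in>F. br f v \<in> W}"
  have "\<exists>v\<in>M - W. \<forall>f\<in>F. br f v \<in> W"
    by (rule engel_propertyD[OF F(2) M W MW]) (use FM FW in auto)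
  then obtain v where v: "v \<in> N" "v \<notin> W" unfolding N_def by blast
  have N_stable: "br y u \<in> N" if "u \<in> N" for u
  proof -
    have u: "u \<in> M" "u \<in> C" "\<And>f. f \<in> F \<Longrightarrow> br f u \<in> W"
      using that sub unfolding N_def by auto
    have "br f (br y u) \<in> W" if f: "f \<in> F" for f
    proof -
      obtain a b where ab: "f \<in> G a" "y \<in> G b"
        using f F(1) y(1) unfolding weight_vectors_def by blast
      have "br (br f y) u \<in> W"
        using sub(1) W(1) u(2,3) y(2)[OF f] by (rule br_span_left)
      moreover have "br y (br f u) \<in> W" using FW u(3)[OF f] by blast
      ultimately show ?thesis
        unfolding br_leibniz[OF ab u(2)] using W(1) by (intro subspace_add subspace_scale)
    qed
    then show ?thesis unfolding N_def using FM u(1) by blast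
  qed
  obtain n where "(br y ^^ n) v = 0"
    using ad_weight_vector_nilpotent y(1) v(1) M unfolding N_def by blast
  then have "\<exists>n. (br y ^^ n) v \<in> W" using subspace_0[OF W(1)] by metis
  then obtain n where n: "(br y ^^ n) v \<in> W" and least: "\<And>m. m < n \<Longrightarrow> (br y ^^ m) v \<notin> W"
    using exists_least_iff[of "\<lambda>n. (br y ^^ n) v \<in> W"] by blast
  then obtain m where m: "n = Suc m" using v(2) by (cases n) auto
  then have "(br y ^^ m) v \<notin> W" using least by blast
  moreover have "(br y ^^ i) v \<in> N" for i by (induction i) (use v N_stable in auto)
  moreover have "br y ((br y ^^ m) v) \<in> W" using n m by simp
  ultimately show "\<exists>v\<in>M - W. \<forall>f\<in>insert y F. br f v \<in> W"
    unfolding N_def by (intro bexI[of _ "(br y ^^ m) v"]) auto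
qed

definition engel_basis :: "'v set \<Rightarrow> bool" where
  "engel_basis F \<longleftrightarrow> finite F \<and> F \<subseteq> weight_vectors \<and> independent F \<and>
     (\<forall>f\<in>F. \<forall>g\<in>F. br f g \<in> span F) \<and> engel_property F"

text \<open>
  Engel's theorem for the action of \<open>F\<close> modulo \<open>span F\<close> gives a weight
  vector \<open>y\<close> outside \<open>span F\<close> that normalizes \<open>span F\<close>.  For
  an odd \<open>y\<close> the vector \<open>[y, y]\<close> may be nonzero and
  \<open>span F + \<langle>y\<rangle>\<close> need not be a subalgebra.  In the case
  \<open>[y, y] \<notin> span F\<close> the vector \<open>[y, y]\<close> takes the role of
  \<open>y\<close>: it normalizes \<open>span F\<close> too, and \<open>[[y, y], [y, y]] = 0\<close>
  because \<open>[y, y]\<close> is even.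
\<close>
lemma engel_basis_extend:
  assumes F: "engel_basis F" and "\<not> weight_vectors \<subseteq> span F"
  shows "\<exists>y. y \<notin> span F \<and> engel_basis (insert y F)"
proof -
  have F': "finite F" "F \<subseteq> weight_vectors" "independent F" "engel_property F"
      "\<And>f g. f \<in> F \<Longrightarrow> g \<in> F \<Longrightarrow> br f g \<in> span F"
    using F unfolding engel_basis_def by auto
  have FC: "F \<subseteq> C" using F'(2) weight_vectors_subset by blast
  have spanC: "span F \<subseteq> C" using FC carrier_subspace by (rule span_minimal)
  have stable: "br f w \<in> span F" if f: "f \<in> F" and w: "w \<in> span F" for f w
    by (rule br_span_right[OF FC subspace_span _ _ w]) (use FC F'(5) f in auto)
  have "\<exists>y\<in>weight_vectors - span F. \<forall>f\<in>F. br f y \<in> span F"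
    by (rule engel_propertyD[OF F'(4) subset_refl subspace_span spanC assms(2)])
      (use F'(2) br_weight_vectors stable in auto)
  then obtain y where y: "y \<in> weight_vectors" "y \<notin> span F" "\<And>f. f \<in> F \<Longrightarrow> br f y \<in> span F"
    by blast
  obtain b where b: "y \<in> G b" using y(1) unfolding weight_vectors_def by blast
  have "\<exists>z. z \<in> weight_vectors \<and> z \<notin> span F \<and> (\<forall>f\<in>F. br f z \<in> span F) \<and> br z z \<in> span F"
  proof (cases "br y y \<in> span F")
    case True
    then show ?thesis using y by blast
  next
    case False
    have even: "br y y \<in> G 0" using br_graded[OF b b] by (cases b) auto
    have "br (br y y) (br y y) = - br (br y y) (br y y)"
      by (subst br_skew[OF even even]) simp
    then have "br (br y y) (br y y) = 0"
      using eq_neg_self_imp_zero[OF vector_space_axioms] by blast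
    moreover have "br f (br y y) \<in> span F" if f: "f \<in> F" for f
    proof -
      obtain a where a: "f \<in> G a" using f F'(2) unfolding weight_vectors_def by blast
      have yg: "br y g \<in> span F" if g: "g \<in> F" for g
      proof -
        obtain c where c: "g \<in> G c" using g F'(2) unfolding weight_vectors_def by blast
        have "br y g = scale (- ksign b c) (br g y)" unfolding br_skew[OF b c] by simp
        then show ?thesis using y(3)[OF g] by (simp only: span_scale)
      qed
      have "br (br f y) y \<in> span F"
        by (rule br_span_left[OF FC subspace_span _ y(3) y(3)[OF f]]) (use b in auto)
      moreover have "br y (br f y) \<in> span F"
        by (rule br_span_right[OF FC subspace_span _ yg y(3)[OF f]]) (use b in auto)
      ultimately show ?thesis
        unfolding br_leibniz[OF a b component_subset[OF b]] by (intro span_add span_scale)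
    qed
    ultimately show ?thesis
      using False br_weight_vectors[OF y(1) y(1)] by (intro exI[of _ "br y y"]) (auto simp: span_zero)
  qed
  then obtain z where z: "z \<in> weight_vectors" "z \<notin> span F" "\<And>f. f \<in> F \<Longrightarrow> br f z \<in> span F"
      "br z z \<in> span F" by blast
  have "br f g \<in> span (insert z F)" if "f \<in> insert z F" "g \<in> insert z F" for f g
  proof -
    have mono: "span F \<subseteq> span (insert z F)" by (rule span_mono) blast
    have zg: "br z g \<in> span F" if g: "g \<in> F" for g
    proof -
      obtain b c where bc: "z \<in> G b" "g \<in> G c"
        using g F'(2) z(1) unfolding weight_vectors_def by blast
      have "br z g = scale (- ksign b c) (br g z)" unfolding br_skew[OF bc] by simp
      then show ?thesis using z(3)[OF g] by (simp only: span_scale)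
    qed
    show ?thesis using that mono z F'(5) zg by blast
  qed
  then have "engel_basis (insert z F)"
    unfolding engel_basis_def
    using F' z engel_extend[OF F'(2,4) z(1,3)] independent_insertI by simp
  then show ?thesis using z(2) by blast
qed

text \<open>
  An \<open>engel_basis\<close> of maximal size spans the whole algebra, by the previous lemma.  Its
  Engel property for \<open>W = {0}\<close> yields \<open>v\<close>.
\<close>
lemma homogeneous_center_nontrivial:
  assumes "C \<noteq> {0}"
  shows "\<exists>a. \<exists>v\<in>G a. v \<noteq> 0 \<and> (\<forall>x\<in>C. br x v = 0)"
proof -
  obtain S where S: "finite S" "C \<subseteq> span S" using carrier_finite by blast
  have bound: "card F \<le> card S" if F: "engel_basis F" for F
  proof -
    have "F \<subseteq> span S" using F S(2) weight_vectors_subset unfolding engel_basis_def by blast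
    moreover have "independent F" using F unfolding engel_basis_def by blast
    ultimately show ?thesis using independent_span_bound[OF S(1)] by blast
  qed
  have "engel_property {}" unfolding engel_property_def by blast
  then have "engel_basis {}" unfolding engel_basis_def by (simp add: independent_empty)
  then have "\<exists>F. engel_basis F \<and> (\<forall>F'. engel_basis F' \<longrightarrow> card F' \<le> card F)"
    by (rule ex_has_greatest_nat[where b = "Suc (card S)"]) (use bound in \<open>auto simp: less_Suc_eq_le\<close>)
  then obtain F where F: "engel_basis F" and max: "\<And>F'. engel_basis F' \<Longrightarrow> card F' \<le> card F"
    by blast
  have FC: "F \<subseteq> C" using F weight_vectors_subset unfolding engel_basis_def by blast
  have "weight_vectors \<subseteq> span F"
  proof (rule ccontr)
    assume "\<not> ?thesis"
    then obtain y where y: "y \<notin> span F" "engel_basis (insert y F)"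
      using engel_basis_extend[OF F] by blast
    have "y \<notin> F" using y(1) span_base by blast
    moreover have "finite F" using F unfolding engel_basis_def by blast
    ultimately show False using max[OF y(2)] by simp
  qed
  then have CF: "C \<subseteq> span F" using weight_vectors_span span_minimal[OF _ subspace_span] by blast
  have "\<not> weight_vectors \<subseteq> {0}"
  proof
    assume "weight_vectors \<subseteq> {0}"
    then have "span weight_vectors \<subseteq> {0}" by (intro span_minimal) auto
    then show False using weight_vectors_span assms by auto
  qed
  moreover have "engel_property F" and F': "F \<subseteq> weight_vectors" using F unfolding engel_basis_def by auto
  ultimately have "\<exists>v\<in>weight_vectors - {0}. \<forall>f\<in>F. br f v \<in> {0}"
    using FC br_weight_vectors by (intro engel_propertyD) auto
  then obtain v where v: "v \<in> weight_vectors" "v \<noteq> 0" "\<And>f. f \<in> F \<Longrightarrow> br f v = 0" by blast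
  have "br x v \<in> {0}" if "x \<in> C" for x
    by (rule br_span_left[OF FC subspace_single_0])
      (use v that CF weight_vectors_subset in auto)
  then show ?thesis using v(1,2) unfolding weight_vectors_def by blast
qed

end

section \<open>The odd derivation associated with the symplectic form\<close>

lemma bilinear_map_onD:
  assumes "bilinear_map_on s s' V f" "x \<in> V" "y \<in> V"
  shows "z \<in> V \<Longrightarrow> f x (y + z) = f x y + f x z"
    and "f x (s c y) = s' c (f x y)"
    and "z \<in> V \<Longrightarrow> f (x + z) y = f x y + f z y"
    and "f (s c x) y = s' c (f x y)"
  using assms unfolding bilinear_map_on_def linear_map_on_def by blast+

context vector_space
begin

lemma linear_map_on_sum:
  assumes "linear_map_on scale (*) V \<phi>" "subspace V" "finite I" "\<And>i. i \<in> I \<Longrightarrow> u i \<in> V"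
  shows "\<phi> (\<Sum>i\<in>I. scale (c i) (u i)) = (\<Sum>i\<in>I. c i * \<phi> (u i))"
  using assms(3,4)
proof (induction rule: finite_induct)
  case empty
  have "\<phi> (scale 0 0) = 0 * \<phi> 0"
    using assms(1) subspace_0[OF assms(2)] unfolding linear_map_on_def by blast
  then show ?case by simp
next
  case (insert j I)
  have "scale (c j) (u j) \<in> V" using insert.prems assms(2) by (intro subspace_scale) auto
  moreover have "(\<Sum>i\<in>I. scale (c i) (u i)) \<in> V"
    using insert.prems assms(2) by (intro subspace_sum subspace_scale) auto
  moreover have "u j \<in> V" using insert.prems by simp
  ultimately show ?case
    using insert assms(1) unfolding linear_map_on_def by simp
qed

text \<open>
  By induction on \<open>F\<close>.  Let \<open>e\<^sub>a\<close> (\<open>a \<in> F\<close>) be dual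
  to \<open>F\<close>.  If every \<open>x\<close> orthogonal to \<open>F\<close> were orthogonal to
  the new vector \<open>b\<close>, then \<open>b - (\<Sum>a\<in>F. f(e\<^sub>a, b) a)\<close> would
  be orthogonal to the whole space, which puts \<open>b\<close> into \<open>span F\<close>.
\<close>
lemma dual_vector_exists:
  assumes V: "subspace V" and f: "bilinear_map_on scale (*) V f" "nondegenerate_on V f"
    and F: "finite F" "F \<subseteq> V" "independent F"
  shows "\<exists>x\<in>V. \<forall>b\<in>F. f x b = g b"
  using F
proof (induction F arbitrary: g rule: finite_induct)
  case empty
  show ?case using subspace_0[OF V] by blast
next
  case (insert b F)
  have b: "b \<in> V" "F \<subseteq> V" "independent F" "b \<notin> span F"
    using insert.prems insert.hyps(2) by (auto simp: independent_insert)
  have lin: "linear_map_on scale (*) V (f x)" "linear_map_on scale (*) V (\<lambda>x. f x y)"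
    if "x \<in> V" "y \<in> V" for x y
    using f(1) that unfolding bilinear_map_on_def by blast+
  have "\<exists>x\<in>V. (\<forall>a\<in>F. f x a = 0) \<and> f x b \<noteq> 0"
  proof (rule ccontr)
    assume "\<not> ?thesis"
    then have contra: "f x b = 0" if "x \<in> V" "\<forall>a\<in>F. f x a = 0" for x using that by blast
    have "\<forall>a. \<exists>x\<in>V. \<forall>a'\<in>F. f x a' = (if a' = a then 1 else 0)"
      by (intro allI insert.IH[OF b(2,3)])
    then obtain e where e: "\<And>a. e a \<in> V" "\<And>a a'. a' \<in> F \<Longrightarrow> f (e a) a' = (if a' = a then 1 else 0)"
      by metis
    \<comment> \<open>\<open>r\<close> is the combination of \<open>F\<close> that has the same products with the dual vectors as \<open>b\<close>.\<close>
    define r where "r = (\<Sum>a\<in>F. scale (f (e a) b) a)"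
    have r: "r \<in> span F" unfolding r_def by (intro span_sum span_scale span_base)
    have rV: "r \<in> V" using r span_minimal[OF b(2) V] by blast
    have "f x (b - r) = 0" if x: "x \<in> V" for x
    proof -
      define x' where "x' = (\<Sum>a\<in>F. scale (f x a) (e a))"
      have x'V: "x' \<in> V" unfolding x'_def using V e(1) by (intro subspace_sum subspace_scale)
      have fx': "f x' y = (\<Sum>a\<in>F. f x a * f (e a) y)" if "y \<in> V" for y
        unfolding x'_def
        using linear_map_on_sum[OF lin(2)[OF x that] V insert.hyps(1), of e] e(1) by simp
      have diff: "f (x - x') y = f x y - f x' y" if "y \<in> V" for y
        using bilinear_map_onD(3)[OF f(1) subspace_diff[OF V x x'V] that x'V] by simp
      have "f (x - x') a' = 0" if a': "a' \<in> F" for a'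
      proof -
        have "f x' a' = (\<Sum>a\<in>F. if a' = a then f x a else 0)"
          unfolding fx'[OF subsetD[OF b(2) a']] by (rule sum.cong) (auto simp: e(2)[OF a'])
        then show ?thesis
          using a' b(2) insert.hyps(1) diff[of a'] by auto
      qed
      then have "f (x - x') b = 0" using contra subspace_diff[OF V x x'V] by blast
      then have "f x b = (\<Sum>a\<in>F. f x a * f (e a) b)" using diff[OF b(1)] fx'[OF b(1)] by simp
      also have "\<dots> = f x r"
        unfolding r_def using linear_map_on_sum[OF lin(1)[OF x x] V insert.hyps(1), of "\<lambda>a. a" "\<lambda>a. f (e a) b"] b(2)
        by (simp add: subset_iff mult.commute)
      finally show ?thesis
        using bilinear_map_onD(1)[OF f(1) x subspace_diff[OF V b(1) rV] rV] by simp
    qed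
    then have "b - r = 0"
      using f(2) subspace_diff[OF V b(1) rV] unfolding nondegenerate_on_def by blast
    then show False using r b(4) by simp
  qed
  then obtain z where z: "z \<in> V" "\<forall>a\<in>F. f z a = 0" "f z b \<noteq> 0" by blast
  obtain x where x: "x \<in> V" "\<forall>a\<in>F. f x a = g a" using insert.IH[OF b(2,3)] by blast
  define y where "y = x + scale ((g b - f x b) / f z b) z"
  have "f y a = f x a + (g b - f x b) / f z b * f z a" if "a \<in> V" for a
    unfolding y_def using bilinear_map_onD(3,4)[OF f(1)] x z that V by (simp add: subspace_scale)
  then have "\<forall>a\<in>insert b F. f y a = g a" using x(2) z(2,3) b by auto
  moreover have "y \<in> V" unfolding y_def using V x(1) z(1) by (intro subspace_add subspace_scale)
  ultimately show ?case by blast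
qed

lemma nondegenerate_form_represents:
  assumes V: "subspace V" and fin: "\<exists>S. finite S \<and> V \<subseteq> span S"
    and f: "bilinear_map_on scale (*) V f" "nondegenerate_on V f"
    and \<phi>: "linear_map_on scale (*) V \<phi>"
  shows "\<exists>x\<in>V. \<forall>y\<in>V. f x y = \<phi> y"
proof -
  obtain F where F: "F \<subseteq> V" "independent F" "V \<subseteq> span F" using maximal_independent_subset by blast
  moreover obtain S where "finite S" "V \<subseteq> span S" using fin by blast
  ultimately have "finite F" using independent_span_bound[of S F] by blast
  then obtain x where x: "x \<in> V" "\<forall>b\<in>F. f x b = \<phi> b"
    using dual_vector_exists[OF V f, of F \<phi>] F by blast
  have "span F \<subseteq> {y \<in> V. f x y = \<phi> y}"
  proof (rule span_minimal)
    have "f x 0 = 0" using bilinear_map_onD(2)[OF f(1) x(1) subspace_0[OF V], of 0] by simp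
    moreover have "\<phi> (scale 0 0) = 0 * \<phi> 0"
      using \<phi> subspace_0[OF V] unfolding linear_map_on_def by blast
    ultimately show "subspace {y \<in> V. f x y = \<phi> y}"
      using V \<phi> bilinear_map_onD(1,2)[OF f(1) x(1)]
      unfolding subspace_def linear_map_on_def by simp
  qed (use F x in auto)
  then show ?thesis using F x by blast
qed

end

context even_quadratic_odd_symplectic
begin

lemmas B_linear [simp] = bilinear_map_onD[OF B_bilinear]
lemmas \<omega>_linear [simp] = bilinear_map_onD[OF \<omega>_bilinear]

lemma B_zero [simp]: "x \<in> C \<Longrightarrow> B x 0 = 0" "x \<in> C \<Longrightarrow> B 0 x = 0"
  using B_linear(2)[of x 0 0] B_linear(4)[of 0 x 0] by auto

lemma B_diff [simp]:
  "\<lbrakk>x \<in> C; y \<in> C; z \<in> C\<rbrakk> \<Longrightarrow> B x (y - z) = B x y - B x z"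
  "\<lbrakk>x \<in> C; y \<in> C; z \<in> C\<rbrakk> \<Longrightarrow> B (x - y) z = B x z - B y z"
  using B_linear(1)[of x "y - z" z] B_linear(3)[of "x - y" z y] by auto

lemma B_minus [simp]:
  "\<lbrakk>x \<in> C; y \<in> C\<rbrakk> \<Longrightarrow> B x (- y) = - B x y"
  "\<lbrakk>x \<in> C; y \<in> C\<rbrakk> \<Longrightarrow> B (- x) y = - B x y"
  using B_diff(1)[of x 0 y] B_diff(2)[of 0 x y] by auto

lemma B_even_odd [simp]: "\<lbrakk>x \<in> G 0; y \<in> G 1\<rbrakk> \<Longrightarrow> B x y = 0" "\<lbrakk>x \<in> G 1; y \<in> G 0\<rbrakk> \<Longrightarrow> B x y = 0"
  using B_even unfolding even_form_def by (metis zero_neq_one)+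

lemma B_sym_even: "\<lbrakk>x \<in> G 0; y \<in> C\<rbrakk> \<Longrightarrow> B y x = B x y"
  by (elim carrierE) (auto simp: B_supersym[of _ 0 x 0])

lemma B_sym_odd: "\<lbrakk>x \<in> G 1; y \<in> C\<rbrakk> \<Longrightarrow> B y x = - B x y"
  by (elim carrierE) (auto simp: B_supersym[of _ 1 x 1])

lemma B_eqI:
  assumes "x \<in> C" "y \<in> C" "\<And>c z. z \<in> G c \<Longrightarrow> B x z = B y z"
  shows "x = y"
proof -
  have "B (x - y) z = 0" if "z \<in> C" for z
    using that by (rule carrierE) (use assms in simp)
  then have "x - y = 0" using B_nondegenerate assms(1,2) unfolding nondegenerate_on_def by blast
  then show ?thesis by simp
qed

lemma associated_map_exists:
  "\<exists>\<delta>. \<forall>x\<in>C. \<delta> x \<in> C \<and> (\<forall>y\<in>C. \<omega> x y = B (\<delta> x) y)"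
proof (rule bchoice, rule ballI)
  fix x assume "x \<in> C"
  then have "linear_map_on scale (*) C (\<omega> x)"
    using \<omega>_bilinear unfolding bilinear_map_on_def by blast
  from nondegenerate_form_represents[OF carrier_subspace carrier_finite B_bilinear B_nondegenerate this]
  obtain z where "z \<in> C" "\<forall>y\<in>C. B z y = \<omega> x y" by blast
  then show "\<exists>z. z \<in> C \<and> (\<forall>y\<in>C. \<omega> x y = B z y)" by (intro exI[of _ z]) simp
qed

end

text \<open>
  The two conditions determine \<open>\<delta>\<close> on the carrier.  Its linearity, degree,
  skewness and bijectivity and the derivation rule all follow from properties of
  \<open>\<omega>\<close> by non-degeneracy of \<open>B\<close>.
\<close>
locale even_quadratic_with_derivation = even_quadratic_odd_symplectic scale G br B \<omega>
  for scale :: "'k::{alg_closed_field, field_char_0} \<Rightarrow> 'v::ab_group_add \<Rightarrow> 'v"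
    and G :: "bit \<Rightarrow> 'v set" and br :: "'v \<Rightarrow> 'v \<Rightarrow> 'v" and B \<omega> :: "'v \<Rightarrow> 'v \<Rightarrow> 'k" +
  fixes \<delta> :: "'v \<Rightarrow> 'v"
  assumes \<delta>_mem [simp, intro]: "x \<in> super_carrier G \<Longrightarrow> \<delta> x \<in> super_carrier G"
    and \<omega>_eq: "\<lbrakk>x \<in> super_carrier G; y \<in> super_carrier G\<rbrakk> \<Longrightarrow> \<omega> x y = B (\<delta> x) y"
begin

lemma \<delta>_add [simp]: "\<lbrakk>x \<in> C; y \<in> C\<rbrakk> \<Longrightarrow> \<delta> (x + y) = \<delta> x + \<delta> y"
  by (rule B_eqI) (auto simp: \<omega>_eq[symmetric])

lemma \<delta>_scale [simp]: "x \<in> C \<Longrightarrow> \<delta> (scale c x) = scale c (\<delta> x)"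
  by (rule B_eqI) (auto simp: \<omega>_eq[symmetric])

lemma \<delta>_zero [simp]: "\<delta> 0 = 0"
  using \<delta>_scale[of 0 0] by simp

lemma \<delta>_diff [simp]: "\<lbrakk>x \<in> C; y \<in> C\<rbrakk> \<Longrightarrow> \<delta> (x - y) = \<delta> x - \<delta> y"
  using \<delta>_add[of "x - y" y] by simp

lemma \<omega>_vanish: "\<lbrakk>x \<in> G a; y \<in> G a\<rbrakk> \<Longrightarrow> \<omega> x y = 0"
  using \<omega>_odd unfolding odd_form_def by blast

lemma \<delta>_even [simp, intro]: assumes "x \<in> G 0" shows "\<delta> x \<in> G 1"
proof -
  have "\<delta> x \<in> C" using assms by blast
  then obtain u v where uv: "u \<in> G 0" "v \<in> G 1" "\<delta> x = u + v" by (rule carrierE)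
  have "u = 0"
  proof (rule B_eqI)
    fix c z assume z: "z \<in> G c"
    show "B u z = B 0 z"
    proof (cases "c = 0")
      case True
      then have "B (\<delta> x) z = 0" using assms z \<omega>_eq[of x z] \<omega>_vanish[of x 0 z] by auto
      then show ?thesis using uv z True by auto
    qed (use uv z in auto)
  qed (use uv in auto)
  then show ?thesis using uv by simp
qed

lemma \<delta>_odd [simp, intro]: assumes "x \<in> G 1" shows "\<delta> x \<in> G 0"
proof -
  have "\<delta> x \<in> C" using assms by blast
  then obtain u v where uv: "u \<in> G 0" "v \<in> G 1" "\<delta> x = u + v" by (rule carrierE)
  have "v = 0"
  proof (rule B_eqI)
    fix c z assume z: "z \<in> G c"
    show "B v z = B 0 z"
    proof (cases "c = 0")
      case False
      then have "B (\<delta> x) z = 0" using assms z \<omega>_eq[of x z] \<omega>_vanish[of x 1 z] by auto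
      then show ?thesis using uv z False by auto
    qed (use uv z in auto)
  qed (use uv in auto)
  then show ?thesis using uv by simp
qed

lemma \<delta>_degree: "x \<in> G a \<Longrightarrow> \<delta> x \<in> G (a + 1)"
  by (cases a) auto

lemma \<delta>_skew_even: assumes "x \<in> G 0" "y \<in> C" shows "B (\<delta> x) y = - B x (\<delta> y)"
proof -
  obtain u v where uv: "u \<in> G 0" "v \<in> G 1" "y = u + v" using assms(2) by (rule carrierE)
  have "B (\<delta> x) v = - B (\<delta> v) x"
    using \<omega>_skew[OF assms(1) uv(2)] assms uv \<omega>_eq by simp
  also have "\<dots> = - B x (\<delta> v)" using B_sym_even[OF assms(1), of "\<delta> v"] uv by simp
  finally show ?thesis using assms(1) uv by simp
qed

lemma \<delta>_skew_odd: assumes "x \<in> G 1" "y \<in> C" shows "B (\<delta> x) y = B x (\<delta> y)"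
proof -
  obtain u v where uv: "u \<in> G 0" "v \<in> G 1" "y = u + v" using assms(2) by (rule carrierE)
  have "B (\<delta> x) u = - B (\<delta> u) x"
    using \<omega>_skew[OF assms(1) uv(1)] assms uv \<omega>_eq by simp
  also have "\<dots> = B x (\<delta> u)" using B_sym_odd[OF assms(1), of "\<delta> u"] uv by simp
  finally show ?thesis using assms(1) uv by simp
qed

text \<open>
  The cocycle identity of \<open>\<omega>\<close>, with each term moved to the form
  \<open>B(-, z)\<close> by invariance.
\<close>
lemma \<delta>_derivation_homogeneous:
  assumes x: "x \<in> G a" and y: "y \<in> G b"
  shows "\<delta> (br x y) = br (\<delta> x) y + scale (ksign 1 a) (br x (\<delta> y))"
proof (rule B_eqI)
  fix c z assume z: "z \<in> G c"
  have C: "x \<in> C" "y \<in> C" "z \<in> C" using x y z by auto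
  have 1: "\<omega> x (br y z) = B (br (\<delta> x) y) z" using C by (simp add: \<omega>_eq B_invariant)
  have 2: "\<omega> y (br z x) = ksign c a * ksign (b + 1) a * B (br x (\<delta> y)) z"
  proof -
    have "\<omega> y (br z x) = - ksign c a * B (br (\<delta> y) x) z"
      unfolding br_skew[OF z x] using C by (simp add: \<omega>_eq B_invariant)
    then show ?thesis unfolding br_skew[OF \<delta>_degree[OF y] x] using C by simp
  qed
  have 3: "\<omega> z (br x y) = - ksign c (a + b) * B (\<delta> (br x y)) z"
    unfolding \<omega>_skew[OF z br_graded[OF x y]] using C by (simp add: \<omega>_eq)
  have J: "ksign c a * \<omega> x (br y z) + ksign a b * \<omega> y (br z x) + ksign b c * \<omega> z (br x y) = 0"
    by (rule \<omega>_cocycle[OF x y z])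
  show "B (\<delta> (br x y)) z = B (br (\<delta> x) y + scale (ksign 1 a) (br x (\<delta> y))) z"
    using J unfolding 1 2 3 using C
    by (cases a; cases b; cases c) (simp_all add: algebra_simps)
qed (use x y in auto)

lemma \<delta>_derivation:
  assumes x: "x \<in> G a" and y: "y \<in> C"
  shows "\<delta> (br x y) = br (\<delta> x) y + scale (ksign 1 a) (br x (\<delta> y))"
proof -
  obtain u v where uv: "u \<in> G 0" "v \<in> G 1" "y = u + v" using y by (rule carrierE)
  then have "\<delta> (br x y) = \<delta> (br x u) + \<delta> (br x v)" using x by simp
  then show ?thesis
    unfolding \<delta>_derivation_homogeneous[OF x uv(1)] \<delta>_derivation_homogeneous[OF x uv(2)]
    using x uv by (simp add: scale_right_distrib)
qed

lemma \<delta>_injective: assumes "x \<in> C" "\<delta> x = 0" shows "x = 0"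
proof -
  have "\<forall>y\<in>C. \<omega> x y = 0" using assms \<omega>_eq by simp
  then show ?thesis using \<omega>_nondegenerate assms(1) unfolding nondegenerate_on_def by blast
qed

lemma \<delta>_bij: "bij_betw \<delta> C C"
  unfolding bij_betw_def
proof
  show "inj_on \<delta> C"
  proof (rule inj_onI)
    fix x y assume xy: "x \<in> C" "y \<in> C" "\<delta> x = \<delta> y"
    have "\<delta> (x - y) = 0" using xy \<delta>_diff[OF xy(1,2)] by (simp only: right_minus_eq)
    then have "x - y = 0" by (rule \<delta>_injective[OF carrier_closed(3)[OF xy(1,2)]])
    then show "x = y" by (simp only: right_minus_eq)
  qed
  have "\<exists>x\<in>C. \<delta> x = y" if y: "y \<in> C" for y
  proof -
    have "linear_map_on scale (*) C (B y)"
      using B_bilinear y unfolding bilinear_map_on_def by blast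
    then obtain x where x: "x \<in> C" "\<forall>z\<in>C. \<omega> x z = B y z"
      using nondegenerate_form_represents[OF carrier_subspace carrier_finite \<omega>_bilinear \<omega>_nondegenerate,
          of "B y"] by blast
    have "\<delta> x = y"
      by (rule B_eqI) (use x y in \<open>auto simp: \<omega>_eq[symmetric]\<close>)
    then show ?thesis using x by blast
  qed
  then show "\<delta> ` C = C" by auto
qed

lemma \<delta>_squared_derivation:
  assumes "x \<in> C" "y \<in> C"
  shows "\<delta> (\<delta> (br x y)) = br (\<delta> (\<delta> x)) y + br x (\<delta> (\<delta> y))"
proof -
  have hom: "\<delta> (\<delta> (br u y)) = br (\<delta> (\<delta> u)) y + br u (\<delta> (\<delta> y))" if u: "u \<in> G a" for u a
  proof -
    have "\<delta> (\<delta> (br u y)) = \<delta> (br (\<delta> u) y) + scale (ksign 1 a) (\<delta> (br u (\<delta> y)))"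
      unfolding \<delta>_derivation[OF u assms(2)] using u assms(2) by simp
    then show ?thesis
      unfolding \<delta>_derivation[OF \<delta>_degree[OF u] assms(2)] \<delta>_derivation[OF u \<delta>_mem[OF assms(2)]]
      by (cases a) (simp_all add: algebra_simps)
  qed
  obtain u v where uv: "u \<in> G 0" "v \<in> G 1" "x = u + v" using assms(1) by (rule carrierE)
  then show ?thesis using hom[OF uv(1)] hom[OF uv(2)] assms(2) by simp
qed

lemma br_\<delta>_central:
  assumes v: "v \<in> C" "\<forall>x\<in>C. br x v = 0" and x: "x \<in> C"
  shows "br x (\<delta> v) = 0"
proof -
  have hom: "br u (\<delta> v) = 0" if u: "u \<in> G a" for u a
  proof -
    have "br u v = 0" "br (\<delta> u) v = 0" using v(2) u by blast+
    then have "scale (ksign 1 a) (br u (\<delta> v)) = 0" using \<delta>_derivation[OF u v(1)] by simp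
    then show ?thesis by (cases a) auto
  qed
  obtain p q where "p \<in> G 0" "q \<in> G 1" "x = p + q" using x by (rule carrierE)
  then show ?thesis using hom v(1) by simp
qed

text \<open>
  The centre is stable under \<open>\<delta>\<close>, and \<open>\<delta>\<close> is injective and
  exchanges the two parities, so the even part of the centre is nonzero as soon as the centre is.
  It is stable under \<open>\<delta>\<^sup>2\<close>, which therefore has an eigenvector there; the
  square root \<open>l\<close> of the eigenvalue becomes the parameter \<open>\<lambda>\<close> of
  the extension.
\<close>
lemma even_central_eigenvector_exists:
  assumes "C \<noteq> {0}"
  shows "\<exists>v\<in>G 0. \<exists>l. v \<noteq> 0 \<and> l \<noteq> 0 \<and> (\<forall>x\<in>C. br x v = 0) \<and> \<delta> (\<delta> v) = scale (l * l) v"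
proof -
  interpret T: lie_superalgebra_with_invertible_derivation scale G br "\<lambda>x. \<delta> (\<delta> x)"
  proof
    show "linear_map_on scale scale C (\<lambda>x. \<delta> (\<delta> x))" unfolding linear_map_on_def by simp
    show "\<delta> (\<delta> x) \<in> G a" if "x \<in> G a" for x a
      using that by (cases a) auto
    show "x = 0" if "x \<in> C" "\<delta> (\<delta> x) = 0" for x
      using that \<delta>_injective \<delta>_mem by blast
  qed (rule \<delta>_squared_derivation)
  define Z where "Z = {v \<in> G 0. \<forall>x\<in>C. br x v = 0}"
  interpret Z: endomorphism_on scale Z "\<lambda>x. \<delta> (\<delta> x)"
  proof
    show "subspace Z" unfolding Z_def subspace_def by auto
    show "\<exists>S. finite S \<and> Z \<subseteq> span S" using carrier_finite unfolding Z_def by blast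
    show "linear_map_on scale scale Z (\<lambda>x. \<delta> (\<delta> x))" unfolding linear_map_on_def Z_def by auto
    show "\<delta> (\<delta> x) \<in> Z" if "x \<in> Z" for x
      using that br_\<delta>_central[of x] br_\<delta>_central[of "\<delta> x"] unfolding Z_def by auto
  qed
  obtain a v where v: "v \<in> G a" "v \<noteq> 0" "\<forall>x\<in>C. br x v = 0"
    using T.homogeneous_center_nontrivial[OF assms] by blast
  have "\<exists>u\<in>Z. u \<noteq> 0"
  proof (cases "a = 0")
    case True
    then show ?thesis using v unfolding Z_def by blast
  next
    case False
    then have "\<delta> v \<in> G 0" using v by auto
    moreover have "\<delta> v \<noteq> 0" using \<delta>_injective v by blast
    ultimately show ?thesis using br_\<delta>_central[OF _ v(3)] v(1) unfolding Z_def by blast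
  qed
  then obtain u where u: "u \<in> Z" "u \<notin> {0}" by blast
  obtain w \<mu> where w: "w \<in> Z" "w \<noteq> 0" "\<delta> (\<delta> w) = scale \<mu> w"
    using Z.relative_eigenvector_exists[OF subspace_single_0 u] by auto
  have "degree [:- \<mu>, 0, 1:] > 0" by simp
  then obtain l where "poly [:- \<mu>, 0, 1:] l = 0" using alg_closed_imp_poly_has_root by blast
  then have l: "\<mu> = l * l" by (simp add: algebra_simps)
  have "\<delta> (\<delta> w) \<noteq> 0" using w(1,2) \<delta>_injective \<delta>_mem unfolding Z_def by blast
  then have "l \<noteq> 0" using w(3) l by auto
  then show ?thesis using w l unfolding Z_def by blast
qed

end

section \<open>Reduction by two central vectors\<close>

lemma (in even_quadratic_with_derivation) associated_derivation:
  "associated_derivation scale G br B \<omega> \<delta>"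
  unfolding associated_derivation_def superderivation_def linear_map_on_def
  using \<delta>_bij \<delta>_derivation \<delta>_degree \<omega>_eq by auto

text \<open>
  The vectors \<open>z0\<close>, \<open>z1\<close> play the role of
  \<open>e\<^sub>0\<^sup>*\<close>, \<open>e\<^sub>1\<^sup>*\<close>.  The products that are not
  listed are determined by supersymmetry, or vanish by parity or because \<open>B\<close> is
  alternating on odd vectors.
\<close>
locale central_hyperbolic_planes = even_quadratic_with_derivation scale G br B \<omega> \<delta>
  for scale :: "'k::{alg_closed_field, field_char_0} \<Rightarrow> 'v::ab_group_add \<Rightarrow> 'v"
    and G :: "bit \<Rightarrow> 'v set" and br :: "'v \<Rightarrow> 'v \<Rightarrow> 'v" and B \<omega> :: "'v \<Rightarrow> 'v \<Rightarrow> 'k"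
    and \<delta> :: "'v \<Rightarrow> 'v" +
  fixes z0 z1 e0 e1 :: 'v and l :: 'k
  assumes homogeneous [simp, intro]: "z0 \<in> G 0" "z1 \<in> G 1" "e0 \<in> G 0" "e1 \<in> G 1"
    and central [simp]: "x \<in> super_carrier G \<Longrightarrow> br x z0 = 0" "x \<in> super_carrier G \<Longrightarrow> br x z1 = 0"
    and \<delta>_z [simp]: "\<delta> z0 = scale l z1" "\<delta> z1 = scale l z0"
    and pairing [simp]: "B z0 z0 = 0" "B z0 e0 = 1" "B e0 e0 = 0" "B z1 e1 = 1"
    and l_nonzero: "l \<noteq> 0"
begin

lemma in_carrier [simp]: "z0 \<in> C" "z1 \<in> C" "e0 \<in> C" "e1 \<in> C"
  using homogeneous by blast+

lemma pairing_sym [simp]: "B e0 z0 = 1" "B e1 z1 = - 1" "B z1 z1 = 0" "B e1 e1 = 0"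
proof -
  show "B e0 z0 = 1" using B_sym_even[of z0 e0] by simp
  show "B e1 z1 = - 1" using B_sym_odd[of z1 e1] by simp
  have "2 * B z1 z1 = 0" "2 * B e1 e1 = 0"
    using B_sym_odd[of z1 z1] B_sym_odd[of e1 e1] by (simp_all only: homogeneous in_carrier mult_2 eq_neg_iff_add_eq_0)
  then show "B z1 z1 = 0" "B e1 e1 = 0" by simp_all
qed

lemma central_left [simp]: assumes "x \<in> C" shows "br z0 x = 0" "br z1 x = 0"
proof -
  obtain u v where uv: "u \<in> G 0" "v \<in> G 1" "x = u + v" using assms by (rule carrierE)
  have "br z0 u = 0" "br z0 v = 0" "br z1 u = 0" "br z1 v = 0"
    using br_skew[of z0 0 u 0] br_skew[of z0 0 v 1] br_skew[of z1 1 u 0] br_skew[of z1 1 v 1] uv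
    by simp_all
  then show "br z0 x = 0" "br z1 x = 0" using uv by simp_all
qed

text \<open>
  The orthogonal projection onto the complement \<open>\<hh>\<close> of the two hyperbolic planes.
\<close>
definition P :: "'v \<Rightarrow> 'v" where
  "P x = x - scale (B x e0) z0 - scale (B x e1) z1 - scale (B z0 x) e0 - scale (B z1 x) e1"

definition H :: "bit \<Rightarrow> 'v set" where
  "H a = {x \<in> G a. B z0 x = 0 \<and> B z1 x = 0 \<and> B x e0 = 0 \<and> B x e1 = 0}"

text \<open>
  The orthogonal space of the central ideal \<open>\<langle>z0, z1\<rangle>\<close>.  It contains
  all brackets, is stable under \<open>\<delta>\<close>, and on it \<open>P\<close> changes a vector
  only by central elements.  So \<open>P\<close> can be dropped inside a bracket, and since
  \<open>\<delta>\<close> preserves the ideal, also inside \<open>P \<circ> \<delta>\<close>.  This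
  turns identities of the given algebra into identities of \<open>\<hh>\<close>.
\<close>
definition perp :: "'v set" where
  "perp = {x \<in> C. B z0 x = 0 \<and> B z1 x = 0}"

abbreviation HC :: "'v set" where "HC \<equiv> super_carrier H"

lemma H_subset: "x \<in> H a \<Longrightarrow> x \<in> G a"
  unfolding H_def by blast

lemma HC_iff: "x \<in> HC \<longleftrightarrow> x \<in> C \<and> B z0 x = 0 \<and> B z1 x = 0 \<and> B x e0 = 0 \<and> B x e1 = 0"
proof
  assume "x \<in> HC"
  then obtain u v where "u \<in> H 0" "v \<in> H 1" "x = u + v" unfolding super_carrier_def by blast
  then show "x \<in> C \<and> B z0 x = 0 \<and> B z1 x = 0 \<and> B x e0 = 0 \<and> B x e1 = 0"
    unfolding H_def by auto
next
  assume x: "x \<in> C \<and> B z0 x = 0 \<and> B z1 x = 0 \<and> B x e0 = 0 \<and> B x e1 = 0"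
  then obtain u v where uv: "u \<in> G 0" "v \<in> G 1" "x = u + v" using carrierE by blast
  then have "u \<in> H 0" "v \<in> H 1" using x unfolding H_def by auto
  then show "x \<in> HC" using uv(3) unfolding super_carrier_def by blast
qed

lemma HC_subset [simp, intro]: "x \<in> HC \<Longrightarrow> x \<in> C"
  by (simp add: HC_iff)

lemma HC_orthogonal [simp]:
  assumes "x \<in> HC"
  shows "B z0 x = 0" "B z1 x = 0" "B e0 x = 0" "B e1 x = 0"
    "B x z0 = 0" "B x z1 = 0" "B x e0 = 0" "B x e1 = 0"
proof -
  have x: "x \<in> C" "B z0 x = 0" "B z1 x = 0" "B x e0 = 0" "B x e1 = 0" using assms HC_iff by auto
  then show "B z0 x = 0" "B z1 x = 0" "B x e0 = 0" "B x e1 = 0" by simp_all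
  show "B e0 x = 0" using B_sym_even[of e0 x] x by simp
  show "B e1 x = 0" using B_sym_odd[of e1 x] x by simp
  show "B x z0 = 0" using B_sym_even[of z0 x] x by simp
  show "B x z1 = 0" using B_sym_odd[of z1 x] x by simp
qed

lemma HC_perp [simp, intro]: "x \<in> HC \<Longrightarrow> x \<in> perp"
  unfolding perp_def by auto

lemma perp_subset [simp, intro]: "x \<in> perp \<Longrightarrow> x \<in> C"
  unfolding perp_def by auto

lemma P_add [simp]: "\<lbrakk>x \<in> C; y \<in> C\<rbrakk> \<Longrightarrow> P (x + y) = P x + P y"
  unfolding P_def by (simp add: scale_left_distrib)

lemma P_scale [simp]: "x \<in> C \<Longrightarrow> P (scale c x) = scale c (P x)"
  unfolding P_def by (simp add: scale_right_diff_distrib)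

lemma P_zero [simp]: "P 0 = 0"
  using P_scale[of 0 0] by simp

lemma P_diff [simp]: "\<lbrakk>x \<in> C; y \<in> C\<rbrakk> \<Longrightarrow> P (x - y) = P x - P y"
  using P_add[of "x - y" y] by simp

lemma P_minus [simp]: "x \<in> C \<Longrightarrow> P (- x) = - P x"
  using P_diff[of 0 x] by simp

lemma P_planes [simp]: "P z0 = 0" "P z1 = 0" "P e0 = 0" "P e1 = 0"
  unfolding P_def by simp_all

lemma P_component: assumes "x \<in> G a" shows "P x \<in> H a"
  using assms unfolding P_def H_def by (cases a) auto

lemma P_mem [simp, intro]: assumes "x \<in> C" shows "P x \<in> HC"
proof -
  obtain u v where uv: "u \<in> G 0" "v \<in> G 1" "x = u + v" using assms by (rule carrierE)
  then show ?thesis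
    unfolding super_carrier_def[of H] using P_component[OF uv(1)] P_component[OF uv(2)] by auto
qed

lemma P_id [simp]: "x \<in> HC \<Longrightarrow> P x = x"
  unfolding P_def by simp

lemma decompose:
  "x = scale (B x e0) z0 + scale (B x e1) z1 + P x + scale (B z0 x) e0 + scale (B z1 x) e1"
  unfolding P_def by simp

lemma B_P_left [simp]: "\<lbrakk>x \<in> C; y \<in> HC\<rbrakk> \<Longrightarrow> B (P x) y = B x y"
  unfolding P_def by simp

lemma B_P_right [simp]: "\<lbrakk>x \<in> HC; y \<in> C\<rbrakk> \<Longrightarrow> B x (P y) = B x y"
  unfolding P_def by simp

lemma perp_orthogonal [simp]:
  assumes "x \<in> perp"
  shows "B z0 x = 0" "B z1 x = 0" "B x z0 = 0" "B x z1 = 0"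
proof -
  have x: "x \<in> C" "B z0 x = 0" "B z1 x = 0" using assms unfolding perp_def by auto
  then show "B z0 x = 0" "B z1 x = 0" by simp_all
  show "B x z0 = 0" using B_sym_even[of z0 x] x by simp
  show "B x z1 = 0" using B_sym_odd[of z1 x] x by simp
qed

lemma B_P_perp: "\<lbrakk>x \<in> perp; y \<in> perp\<rbrakk> \<Longrightarrow> B x (P y) = B x y"
  unfolding P_def by simp

lemma br_P_left [simp]: "\<lbrakk>x \<in> perp; y \<in> C\<rbrakk> \<Longrightarrow> br (P x) y = br x y"
  unfolding P_def perp_def by simp

lemma br_P_right [simp]: "\<lbrakk>x \<in> perp; y \<in> C\<rbrakk> \<Longrightarrow> br y (P x) = br y x"
  unfolding P_def perp_def by simp

lemma P_\<delta>_P [simp]: "x \<in> perp \<Longrightarrow> P (\<delta> (P x)) = P (\<delta> x)"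
  unfolding P_def[of x] perp_def by simp

lemma br_perp [simp]: "\<lbrakk>x \<in> C; y \<in> C\<rbrakk> \<Longrightarrow> br x y \<in> perp"
  unfolding perp_def by (simp add: B_invariant[symmetric])

lemma \<delta>_perp [simp]: "x \<in> perp \<Longrightarrow> \<delta> x \<in> perp"
  using \<delta>_skew_even[of z0 x] \<delta>_skew_odd[of z1 x] unfolding perp_def by auto

definition brh :: "'v \<Rightarrow> 'v \<Rightarrow> 'v" where "brh x y = P (br x y)"

definition \<delta>h :: "'v \<Rightarrow> 'v" where "\<delta>h x = P (\<delta> x)"

definition D :: "'v \<Rightarrow> 'v" where "D x = P (br e0 x)"

definition Db :: "'v \<Rightarrow> 'v" where "Db x = P (br e1 x)"

lemma H_components:
  "0 \<in> H a" "\<lbrakk>x \<in> H a; y \<in> H a\<rbrakk> \<Longrightarrow> x + y \<in> H a" "x \<in> H a \<Longrightarrow> scale c x \<in> H a"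
  unfolding H_def by auto

lemma superspace_H: "superspace scale H"
proof
  show "subspace (H a)" for a unfolding subspace_def using H_components by auto
  have "H 0 \<inter> H 1 \<subseteq> G 0 \<inter> G 1" unfolding H_def by blast
  then show "H 0 \<inter> H 1 = {0}" using components_disjoint H_components(1)[of 0] H_components(1)[of 1] by auto
  obtain F where F: "F \<subseteq> HC" "independent F" "HC \<subseteq> span F" using maximal_independent_subset by blast
  obtain S where S: "finite S" "C \<subseteq> span S" using carrier_finite by blast
  have "F \<subseteq> span S" using F(1) S(2) HC_subset by blast
  then have "finite F" using independent_span_bound[OF S(1) F(2)] by blast
  moreover have "subspace HC" unfolding subspace_def HC_iff by simp
  then have "span F = HC" by (intro equalityI span_minimal F)
  ultimately show "\<exists>S. finite S \<and> span S = HC" by blast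
qed

lemma \<delta>h_mem [simp]: "x \<in> HC \<Longrightarrow> \<delta>h x \<in> HC"
  unfolding \<delta>h_def by simp

lemma \<omega>_\<delta>h: "\<lbrakk>x \<in> HC; y \<in> HC\<rbrakk> \<Longrightarrow> \<omega> x y = B (\<delta>h x) y"
  unfolding \<delta>h_def by (simp add: \<omega>_eq)

lemma B_nondegenerate_H: "nondegenerate_on HC B"
  unfolding nondegenerate_on_def
proof (intro conjI ballI impI)
  fix x assume x: "x \<in> HC" "\<forall>y\<in>HC. B x y = 0"
  have "\<forall>y\<in>C. B x y = 0" using x by (metis B_P_right P_mem)
  then show "x = 0" using B_nondegenerate x(1) unfolding nondegenerate_on_def by blast
next
  fix y assume y: "y \<in> HC" "\<forall>x\<in>HC. B x y = 0"
  have "\<forall>x\<in>C. B x y = 0" using y by (metis B_P_left P_mem)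
  then show "y = 0" using B_nondegenerate y(1) unfolding nondegenerate_on_def by blast
qed

text \<open>
  If \<open>P (\<delta> x) = 0\<close>, then \<open>\<delta> x\<close>, being orthogonal to the
  ideal \<open>\<langle>z0, z1\<rangle>\<close>, lies in
  \<open>\<langle>z0, z1\<rangle> = \<delta> \<langle>z0, z1\<rangle>\<close>, hence
  \<open>x\<close> does, and this ideal meets \<open>\<hh>\<close> only in zero.
\<close>
lemma \<delta>h_injective: assumes x: "x \<in> HC" and "\<delta>h x = 0" shows "x = 0"
proof -
  have "\<delta> x \<in> perp" using x by simp
  then have "\<delta> x = scale (B (\<delta> x) e0) z0 + scale (B (\<delta> x) e1) z1"
    using assms(2) unfolding \<delta>h_def perp_def by - (rule trans[OF decompose], simp)
  also have "\<dots> = \<delta> (scale (B (\<delta> x) e0 / l) z1 + scale (B (\<delta> x) e1 / l) z0)"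
    using l_nonzero by simp
  finally have "\<delta> (x - (scale (B (\<delta> x) e0 / l) z1 + scale (B (\<delta> x) e1 / l) z0)) = 0"
    using x by (subst \<delta>_diff) auto
  then have "x - (scale (B (\<delta> x) e0 / l) z1 + scale (B (\<delta> x) e1 / l) z0) = 0"
    using x by (intro \<delta>_injective[OF carrier_closed(3)]) auto
  then have eq: "x = scale (B (\<delta> x) e0 / l) z1 + scale (B (\<delta> x) e1 / l) z0" by simp
  have "P x = P (scale (B (\<delta> x) e0 / l) z1 + scale (B (\<delta> x) e1 / l) z0)" using eq by (rule arg_cong)
  then show ?thesis using x by simp
qed

lemma \<delta>h_surjective: assumes y: "y \<in> HC" shows "\<exists>x\<in>HC. \<delta>h x = y"
proof -
  have "y \<in> \<delta> ` C" using \<delta>_bij HC_subset[OF y] by (simp only: bij_betw_def)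
  then obtain x where x: "x \<in> C" "\<delta> x = y" by blast
  have "l * B z1 x = 0" "l * B z0 x = 0"
    using \<delta>_skew_even[of z0 x] \<delta>_skew_odd[of z1 x] x y by simp_all
  then have "x \<in> perp" using l_nonzero x(1) unfolding perp_def by simp
  then have "\<delta>h (P x) = y" unfolding \<delta>h_def using x y by simp
  then show ?thesis using x(1) by blast
qed

lemma \<omega>_nondegenerate_H: "nondegenerate_on HC \<omega>"
  unfolding nondegenerate_on_def
proof (intro conjI ballI impI)
  fix x assume x: "x \<in> HC" "\<forall>y\<in>HC. \<omega> x y = 0"
  then have "\<forall>y\<in>HC. B (\<delta>h x) y = 0" by (simp add: \<omega>_\<delta>h)
  then have "\<delta>h x = 0" using B_nondegenerate_H x(1) \<delta>h_mem unfolding nondegenerate_on_def by blast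
  then show "x = 0" using x(1) \<delta>h_injective by blast
next
  fix y assume y: "y \<in> HC" "\<forall>x\<in>HC. \<omega> x y = 0"
  have "B z y = 0" if z: "z \<in> HC" for z
  proof -
    obtain x where x: "x \<in> HC" "\<delta>h x = z" using \<delta>h_surjective[OF z] by blast
    have "B z y = \<omega> x y" unfolding \<omega>_\<delta>h[OF x(1) y(1)] x(2) by (rule refl)
    then show ?thesis using y(2) x(1) by simp
  qed
  then show "y = 0" using B_nondegenerate_H y(1) unfolding nondegenerate_on_def by blast
qed

lemma bilinear_map_on_reduction:
  assumes "bilinear_map_on scale s' C f" shows "bilinear_map_on scale s' HC f"
  using assms HC_subset unfolding bilinear_map_on_def linear_map_on_def by meson

lemma reduction_even_quadratic_odd_symplectic:
  "even_quadratic_odd_symplectic scale H brh B \<omega>"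
proof -
  interpret h: superspace scale H by (rule superspace_H)
  show ?thesis
  proof
    show "bilinear_map_on scale scale HC brh"
      unfolding bilinear_map_on_def linear_map_on_def brh_def by simp
    show "brh x y \<in> H (a + b)" if "x \<in> H a" "y \<in> H b" for x y a b
      unfolding brh_def using that by (intro P_component br_graded H_subset)
    show "brh x y = - scale (ksign a b) (brh y x)" if "x \<in> H a" "y \<in> H b" for x y a b
    proof -
      have g: "x \<in> G a" "y \<in> G b" using that H_subset by blast+
      have "x \<in> C" "y \<in> C" using g by blast+
      then show ?thesis unfolding brh_def br_skew[OF g] by simp
    qed
    show "scale (ksign a c) (brh x (brh y z)) + scale (ksign a b) (brh y (brh z x))
        + scale (ksign b c) (brh z (brh x y)) = 0"
      if xyz: "x \<in> H a" "y \<in> H b" "z \<in> H c" for x y z a b c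
    proof -
      have g: "x \<in> G a" "y \<in> G b" "z \<in> G c" using xyz H_subset by blast+
      then have "P (scale (ksign a c) (br x (br y z)) + scale (ksign a b) (br y (br z x))
          + scale (ksign b c) (br z (br x y))) = 0"
        by (simp only: br_jacobi P_zero)
      moreover have "x \<in> C" "y \<in> C" "z \<in> C" using g by blast+
      ultimately show ?thesis unfolding brh_def by simp
    qed
    show "bilinear_map_on scale (*) HC B" "bilinear_map_on scale (*) HC \<omega>"
      using B_bilinear \<omega>_bilinear by (auto intro: bilinear_map_on_reduction)
    show "even_form H B" "odd_form H \<omega>"
      using B_even \<omega>_odd H_subset unfolding even_form_def odd_form_def by meson+
    show "B x y = ksign a b * B y x" if "x \<in> H a" "y \<in> H b" for x y a b
      using that by (intro B_supersym H_subset)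
    show "\<omega> x y = - (ksign a b * \<omega> y x)" if "x \<in> H a" "y \<in> H b" for x y a b
      using that by (intro \<omega>_skew H_subset)
    show "B (brh x y) z = B x (brh y z)" if "x \<in> HC" "y \<in> HC" "z \<in> HC" for x y z
      unfolding brh_def using that by (simp add: B_invariant)
    show "ksign c a * \<omega> x (brh y z) + ksign a b * \<omega> y (brh z x) + ksign b c * \<omega> z (brh x y) = 0"
      if xyz: "x \<in> H a" "y \<in> H b" "z \<in> H c" for x y z a b c
    proof -
      have h: "x \<in> HC" "y \<in> HC" "z \<in> HC" using xyz h.component_subset by blast+
      have "\<omega> u (brh v w) = \<omega> u (br v w)" if "u \<in> HC" "v \<in> HC" "w \<in> HC" for u v w
      proof -
        have "br v w \<in> perp" "\<delta> u \<in> perp" using that by simp_all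
        then have "B (\<delta> u) (P (br v w)) = B (\<delta> u) (br v w)" by (intro B_P_perp)
        then show ?thesis unfolding brh_def using that by (simp add: \<omega>_eq)
      qed
      then show ?thesis
        using \<omega>_cocycle[of x a y b z c] xyz H_subset h by simp
    qed
  qed (rule B_nondegenerate_H \<omega>_nondegenerate_H)+
qed

sublocale h: even_quadratic_with_derivation scale H brh B \<omega> \<delta>h
proof -
  interpret h: even_quadratic_odd_symplectic scale H brh B \<omega>
    by (rule reduction_even_quadratic_odd_symplectic)
  show "even_quadratic_with_derivation scale H brh B \<omega> \<delta>h"
    by unfold_locales (auto simp: \<omega>_\<delta>h)
qed

end

section \<open>The data of the double extension\<close>

lemma (in superspace) parity_aut_sum:
  assumes "u \<in> G 0" "v \<in> G 1"
  shows "parity_aut G (u + v) = u - v"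
  unfolding parity_aut_def
proof (rule the_equality)
  show "\<exists>u'\<in>G 0. \<exists>v'\<in>G 1. u + v = u' + v' \<and> u - v = u' - v'" using assms by blast
next
  fix Z assume "\<exists>u'\<in>G 0. \<exists>v'\<in>G 1. u + v = u' + v' \<and> Z = u' - v'"
  then obtain u' v' where *: "u' \<in> G 0" "v' \<in> G 1" "u + v = u' + v'" "Z = u' - v'" by blast
  have eq: "u - u' = v' - v" using *(3) by (simp add: algebra_simps)
  have "u - u' \<in> G 0 \<inter> G 1"
    using component_closed(3)[OF assms(1) *(1)] component_closed(3)[OF *(2) assms(2)] by (simp add: eq)
  then have "u - u' = 0" "v' - v = 0" unfolding eq using components_disjoint by auto
  then show "Z = u - v" using *(4) by simp
qed

context central_hyperbolic_planes
begin

text \<open>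
  These are the \<open>\<hh>\<close>-components of \<open>[e\<^sub>1, e\<^sub>1]\<close>,
  \<open>[e\<^sub>0, e\<^sub>1]\<close>, \<open>\<delta>(e\<^sub>1)\<close>,
  \<open>\<delta>(e\<^sub>0)\<close> and the coefficients \<open>k\<close> and
  \<open>\<alpha>\<close> of these vectors along \<open>e\<^sub>0\<^sup>*\<close> and
  \<open>e\<^sub>1\<^sup>*\<close>.  The relations required of them are the projections of the
  Jacobi identities and of the derivation rule for \<open>\<delta>\<close> that involve
  \<open>e\<^sub>0\<close> and \<open>e\<^sub>1\<close>; the two scalar relations are obtained by
  pairing such identities with \<open>e\<^sub>1\<close>.
\<close>
definition x0 :: 'v where "x0 = P (br e1 e1)"
definition x1 :: 'v where "x1 = P (br e0 e1)"
definition c0 :: 'v where "c0 = P (\<delta> e1)"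
definition c1 :: 'v where "c1 = P (\<delta> e0)"
definition k :: 'k where "k = B (br e1 e1) e0"
definition \<alpha> :: 'k where "\<alpha> = B (\<delta> e0) e1"

lemma data_mem: "x0 \<in> H 0" "x1 \<in> H 1" "c0 \<in> H 0" "c1 \<in> H 1"
  unfolding x0_def x1_def c0_def c1_def
  using br_graded[of e1 1 e1 1] br_graded[of e0 0 e1 1] by (auto intro!: P_component)

lemma data_HC [simp]: "x0 \<in> HC" "x1 \<in> HC" "c0 \<in> HC" "c1 \<in> HC"
  using data_mem h.component_subset by blast+

lemma data_C [simp]: "x0 \<in> C" "x1 \<in> C" "c0 \<in> C" "c1 \<in> C"
  using data_HC HC_subset by blast+

lemma br_even_self: assumes "x \<in> G 0" shows "br x x = 0"
proof (rule eq_neg_self_imp_zero[OF vector_space_axioms])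
  show "br x x = - br x x" by (subst br_skew[OF assms assms]) simp
qed

lemma br_e0_e0 [simp]: "br e0 e0 = 0"
  by (rule br_even_self) simp

lemma br_e1_e0: "br e1 e0 = - br e0 e1"
  using br_skew[of e1 1 e0 0] by simp

lemma br_e0_right: "x \<in> C \<Longrightarrow> br x e0 = - br e0 x"
  by (elim carrierE) (simp add: br_skew[of _ 0 e0 0] br_skew[of _ 1 e0 0])

lemma br_e1_right: assumes "u \<in> G 0" "v \<in> G 1" shows "br (u + v) e1 = - br e1 (u - v)"
  using assms by (simp add: br_skew[of u 0 e1 1] br_skew[of v 1 e1 1])

lemma \<delta>_e0: "\<delta> e0 = scale \<alpha> z1 + c1 + scale l e1"
proof -
  have "\<delta> e0 \<in> G 1" by simp
  moreover have "B z1 (\<delta> e0) = l" using \<delta>_skew_odd[of z1 e0] by simp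
  ultimately show ?thesis by - (rule trans[OF decompose], simp add: c1_def \<alpha>_def)
qed

lemma \<delta>_e1: "\<delta> e1 = - scale \<alpha> z0 + c0 - scale l e0"
proof -
  have "\<delta> e1 \<in> G 0" by simp
  moreover have "B z0 (\<delta> e1) = - l" using \<delta>_skew_even[of z0 e1] by simp
  moreover have "B (\<delta> e1) e0 = - \<alpha>"
    using \<delta>_skew_odd[of e1 e0] B_sym_odd[of e1 "\<delta> e0"] unfolding \<alpha>_def by simp
  ultimately show ?thesis by - (rule trans[OF decompose], simp add: c0_def)
qed

lemma br_e1_e1: "br e1 e1 = scale k z0 + x0"
proof -
  have "br e1 e1 \<in> G 0" using br_graded[of e1 1 e1 1] by simp
  moreover have "br e1 e1 \<in> perp" by simp
  ultimately show ?thesis by - (rule trans[OF decompose], simp add: x0_def k_def del: br_perp)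
qed

text \<open>
  Invariance is the reason why a single scalar \<open>k\<close> occurs in both
  \<open>[e\<^sub>0, e\<^sub>1]\<close> and \<open>[e\<^sub>1, e\<^sub>1]\<close>.
\<close>
lemma B_e0_e1_e1: "B (br e0 e1) e1 = k"
  unfolding k_def using B_sym_even[of e0 "br e1 e1"] by (simp add: B_invariant)

lemma br_e0_e1: "br e0 e1 = scale k z1 + x1"
proof -
  have "br e0 e1 \<in> G 1" using br_graded[of e0 0 e1 1] by simp
  moreover have "br e0 e1 \<in> perp" by simp
  ultimately show ?thesis
    by - (rule trans[OF decompose], simp add: x1_def B_e0_e1_e1 del: br_perp)
qed

lemma br_x0 [simp]: "x \<in> C \<Longrightarrow> br x0 x = br (br e1 e1) x" "x \<in> C \<Longrightarrow> br x x0 = br x (br e1 e1)"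
  and br_x1 [simp]: "x \<in> C \<Longrightarrow> br x1 x = br (br e0 e1) x" "x \<in> C \<Longrightarrow> br x x1 = br x (br e0 e1)"
  unfolding x0_def x1_def by simp_all

lemma D_superderivation: "superderivation scale H brh 0 D"
  unfolding superderivation_def
proof (intro conjI allI ballI)
  show "linear_map_on scale scale HC D" unfolding linear_map_on_def D_def by simp
  fix a show "D ` H a \<subseteq> H (a + 0)"
  proof (rule image_subsetI)
    fix x assume "x \<in> H a"
    then show "D x \<in> H (a + 0)"
      unfolding D_def using br_graded[of e0 0 x a] H_subset by (auto intro!: P_component)
  qed
  fix x y assume x: "x \<in> H a" and y: "y \<in> HC"
  have g: "x \<in> G a" "x \<in> C" using x H_subset by auto
  have "P (br e0 (br x y)) = P (br (br e0 x) y + br x (br e0 y))"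
    using br_leibniz[of e0 0 x a y] g y by simp
  then show "D (brh x y) = brh (D x) y + scale (ksign 0 a) (brh x (D y))"
    unfolding D_def brh_def using g y by simp
qed

lemma Db_superderivation: "superderivation scale H brh 1 Db"
  unfolding superderivation_def
proof (intro conjI allI ballI)
  show "linear_map_on scale scale HC Db" unfolding linear_map_on_def Db_def by simp
  fix a show "Db ` H a \<subseteq> H (a + 1)"
  proof (rule image_subsetI)
    fix x assume "x \<in> H a"
    then show "Db x \<in> H (a + 1)"
      unfolding Db_def using br_graded[of e1 1 x a] H_subset by (auto intro!: P_component simp: add.commute)
  qed
  fix x y assume x: "x \<in> H a" and y: "y \<in> HC"
  have g: "x \<in> G a" "x \<in> C" using x H_subset by auto
  have "P (br e1 (br x y)) = P (br (br e1 x) y + scale (ksign 1 a) (br x (br e1 y)))"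
    using br_leibniz[of e1 1 x a y] g y by simp
  then show "Db (brh x y) = brh (Db x) y + scale (ksign 1 a) (brh x (Db y))"
    unfolding Db_def brh_def using g y by simp
qed

lemma ad_skew:
  assumes "e \<in> G d" "x \<in> G a" "y \<in> C"
  shows "B (br e x) y = - (ksign d a * B x (br e y))"
proof -
  have "e \<in> C" "x \<in> C" using assms by blast+
  then have "B x (br e y) = B (br x e) y" using assms(3) by (simp add: B_invariant)
  also have "\<dots> = - ksign a d * B (br e x) y"
    unfolding br_skew[OF assms(2,1)] using \<open>e \<in> C\<close> \<open>x \<in> C\<close> assms(3) by simp
  finally show ?thesis by (cases a; cases d) simp_all
qed

lemma D_skew: "skew_supersymmetric H B 0 D"
  unfolding skew_supersymmetric_def
proof (intro allI ballI)
  fix a x y assume x: "x \<in> H a" and y: "y \<in> HC"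
  have "x \<in> G a" "x \<in> C" "x \<in> HC" using x H_subset h.component_subset by auto
  then show "B (D x) y = - (ksign 0 a * B x (D y))"
    unfolding D_def using ad_skew[of e0 0 x a y] y by simp
qed

lemma Db_skew: "skew_supersymmetric H B 1 Db"
  unfolding skew_supersymmetric_def
proof (intro allI ballI)
  fix a x y assume x: "x \<in> H a" and y: "y \<in> HC"
  have "x \<in> G a" "x \<in> C" "x \<in> HC" using x H_subset h.component_subset by auto
  then show "B (Db x) y = - (ksign 1 a * B x (Db y))"
    unfolding Db_def using ad_skew[of e1 1 x a y] y by simp
qed

lemma br_e1_twice:
  assumes "x \<in> C" shows "br (br e1 e1) x = scale 2 (br e1 (br e1 x))"
proof -
  have "br e1 (br e1 x) = br (br e1 e1) x - br e1 (br e1 x)"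
    using br_leibniz[of e1 1 e1 1 x] assms by simp
  then have "br (br e1 e1) x = br e1 (br e1 x) + br e1 (br e1 x)" by (simp only: eq_diff_eq)
  also have "\<dots> = scale (1 + 1) (br e1 (br e1 x))" by (simp only: scale_left_distrib scale_one)
  finally show ?thesis by simp
qed

lemma Db_twice: "X \<in> HC \<Longrightarrow> Db (Db X) = scale (1/2) (brh x0 X)"
  unfolding Db_def brh_def by (simp add: br_e1_twice)

text \<open>
  \<open>[[e\<^sub>1, e\<^sub>1], e\<^sub>1]\<close> equals
  \<open>2 [e\<^sub>1, [e\<^sub>1, e\<^sub>1]]\<close> by the Jacobi identity and
  \<open>- [e\<^sub>1, [e\<^sub>1, e\<^sub>1]]\<close> by skew-symmetry.
\<close>
lemma e1_cubed: "br (br e1 e1) e1 = 0" "br e1 (br e1 e1) = 0"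
proof -
  have "br e1 e1 \<in> G 0" using br_graded[of e1 1 e1 1] by simp
  then have "br e1 (br e1 e1) = - br (br e1 e1) e1" using br_skew[of e1 1 "br e1 e1" 0] by simp
  moreover have "br (br e1 e1) e1 = scale 2 (br e1 (br e1 e1))" by (rule br_e1_twice) simp
  ultimately have "br e1 (br e1 e1) = - scale 2 (br e1 (br e1 e1))" by metis
  then have "scale 1 (br e1 (br e1 e1)) + scale 2 (br e1 (br e1 e1)) = 0"
    unfolding eq_neg_iff_add_eq_0 by (simp only: scale_one)
  then have "scale (1 + 2) (br e1 (br e1 e1)) = 0" by (simp only: scale_left_distrib)
  then show "br e1 (br e1 e1) = 0" by simp
  with \<open>br e1 (br e1 e1) = - br (br e1 e1) e1\<close> show "br (br e1 e1) e1 = 0" by simp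
qed

lemma Db_x0: "Db x0 = 0"
  unfolding Db_def by (simp add: e1_cubed)

lemma B_x0_x0: "B x0 x0 = 0"
proof -
  have "B (br e1 e1) (br e1 e1) = B (br (br e1 e1) e1) e1" by (simp add: B_invariant)
  then have "B (br e1 e1) (br e1 e1) = 0" by (simp add: e1_cubed)
  then show ?thesis unfolding br_e1_e1 by simp
qed

lemma D_Db: "X \<in> HC \<Longrightarrow> supercommutator scale 0 1 D Db X = brh x1 X"
  unfolding supercommutator_def D_def Db_def brh_def
  using br_leibniz[of e0 0 e1 1 X] by simp

lemma D_x0: "D x0 = scale 2 (Db x1)"
proof -
  have "br e0 e1 \<in> G 1" using br_graded[of e0 0 e1 1] by simp
  then have "br (br e0 e1) e1 = br e1 (br e0 e1)" using br_skew[of "br e0 e1" 1 e1 1] by simp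
  then have "br e0 (br e1 e1) = br e1 (br e0 e1) + br e1 (br e0 e1)"
    using br_leibniz[of e0 0 e1 1 e1] by simp
  also have "\<dots> = scale (1 + 1) (br e1 (br e0 e1))" by (simp only: scale_left_distrib scale_one)
  finally show ?thesis unfolding D_def Db_def by simp
qed

lemma \<delta>h_D: assumes X: "X \<in> HC"
  shows "supercommutator scale 1 0 \<delta>h D X - scale l (Db X) = brh c1 X"
proof -
  have "\<delta> (br e0 X) = br (scale \<alpha> z1 + c1 + scale l e1) X + br e0 (\<delta> X)"
    using \<delta>_derivation[of e0 0 X] X unfolding \<delta>_e0 by simp
  then have "P (\<delta> (br e0 X)) = P (br c1 X) + scale l (P (br e1 X)) + P (br e0 (\<delta> X))"
    using X by simp
  then show ?thesis
    unfolding supercommutator_def \<delta>h_def D_def Db_def brh_def using X by simp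
qed

lemma \<delta>h_Db: assumes X: "X \<in> HC"
  shows "supercommutator scale 1 1 \<delta>h Db X + scale l (D X) = brh c0 X"
proof -
  have "\<delta> (br e1 X) = br (- scale \<alpha> z0 + c0 - scale l e0) X - br e1 (\<delta> X)"
    using \<delta>_derivation[of e1 1 X] X unfolding \<delta>_e1 by simp
  then have "P (\<delta> (br e1 X)) = P (br c0 X) - scale l (P (br e0 X)) - P (br e1 (\<delta> X))"
    using X by simp
  then show ?thesis
    unfolding supercommutator_def \<delta>h_def D_def Db_def brh_def using X by simp
qed

lemma \<delta>_br_e1_e1: "\<delta> (br e1 e1) = scale (- 2) (br e1 c0) - scale (2 * l) (br e0 e1)"
proof -
  have c0e1: "br c0 e1 = - br e1 c0"
    using br_skew[of c0 0 e1 1] data_mem(3) H_subset by auto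
  have "\<delta> (br e1 e1) = br (- scale \<alpha> z0 + c0 - scale l e0) e1 - br e1 (- scale \<alpha> z0 + c0 - scale l e0)"
    using \<delta>_derivation[of e1 1 e1] unfolding \<delta>_e1 by simp
  also have "\<dots> = - (br e1 c0 + br e1 c0) - scale l (br e0 e1 + br e0 e1)"
    by (simp add: c0e1 br_e1_e0 algebra_simps)
  also have "\<dots> = scale (- 2) (br e1 c0) - scale (2 * l) (br e0 e1)"
    using scale_left_distrib[of 1 1 "br e1 c0"] scale_left_distrib[of 1 1 "br e0 e1"]
    by (simp add: mult.commute[of 2 l] flip: scale_scale)
  finally show ?thesis .
qed

lemma \<delta>h_x0: "\<delta>h x0 = - scale (2 * l) x1 - scale 2 (Db c0)"
proof -
  have "\<delta>h x0 = P (\<delta> (br e1 e1))" unfolding \<delta>h_def x0_def by simp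
  then show ?thesis unfolding \<delta>_br_e1_e1 x1_def Db_def by simp
qed

lemma \<delta>h_x1: "\<delta>h x1 = scale l x0 + D c0 + Db c1"
proof -
  have c1e1: "br c1 e1 = br e1 c1"
    using br_skew[of c1 1 e1 1] data_mem(4) H_subset by auto
  have "\<delta> (br e0 e1) = br (scale \<alpha> z1 + c1 + scale l e1) e1 + br e0 (- scale \<alpha> z0 + c0 - scale l e0)"
    using \<delta>_derivation[of e0 0 e1] unfolding \<delta>_e0 \<delta>_e1 by simp
  then have "\<delta> (br e0 e1) = br e1 c1 + scale l (br e1 e1) + br e0 c0"
    by (simp add: c1e1)
  moreover have "\<delta>h x1 = P (\<delta> (br e0 e1))" unfolding \<delta>h_def x1_def by simp
  ultimately show ?thesis unfolding x0_def D_def Db_def by simp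
qed

text \<open>
  Evaluate \<open>B (\<delta> [e\<^sub>1, e\<^sub>1]) e\<^sub>1\<close> by the derivation rule and
  by skewness of \<open>\<delta>\<close>: the results are
  \<open>2 B(c\<^sub>0, x\<^sub>0) - 2 l k\<close> and \<open>l k - B(c\<^sub>0, x\<^sub>0)\<close>,
  and \<open>3\<close> is invertible.
\<close>
lemma l_k: "l * k = B c0 x0"
proof -
  have even: "br e1 e1 \<in> G 0" using br_graded[of e1 1 e1 1] by simp
  have "B x0 c0 = B c0 x0" using B_sym_even[of c0 x0] data_mem(3) H_subset by simp
  have sk: "B (\<delta> (br e1 e1)) e1 = - B (br e1 e1) (\<delta> e1)"
    using even by (rule \<delta>_skew_even) simp
  have "B (br e1 c0) e1 = - B c0 (br e1 e1)"
    using ad_skew[of e1 1 c0 0 e1] data_mem(3) H_subset by simp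
  then have "B (br e1 c0) e1 = - B c0 x0" unfolding br_e1_e1 by simp
  then have lhs: "B (\<delta> (br e1 e1)) e1 = 2 * B c0 x0 - 2 * l * k"
    unfolding \<delta>_br_e1_e1 by (simp add: B_e0_e1_e1)
  have "B (br e1 e1) (\<delta> e1) = B c0 x0 - l * k"
    unfolding \<delta>_e1 br_e1_e1 using \<open>B x0 c0 = B c0 x0\<close> by simp
  then have "2 * B c0 x0 - 2 * l * k = - (B c0 x0 - l * k)" using sk lhs by (simp only:)
  then have "3 * (l * k - B c0 x0) = 0" by algebra
  then show ?thesis by simp
qed

lemma reduction_data: "double_extension_data scale H brh B \<omega> \<delta>h D Db x0 x1 c0 c1 k l"
  by unfold_locales
    (fact h.associated_derivation D_superderivation D_skew Db_superderivation Db_skew data_mem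
      l_nonzero Db_twice Db_x0 B_x0_x0 D_Db D_x0 \<delta>h_D \<delta>h_Db \<delta>h_x0 \<delta>h_x1 l_k)+

section \<open>The isomorphism with the double extension\<close>

definition coordinates :: "'v \<Rightarrow> ('k, 'v) dext" where
  "coordinates x = (B x e0, B x e1, P x, B z0 x, B z1 x)"

lemma coordinates_add [simp]:
    "\<lbrakk>x \<in> C; y \<in> C\<rbrakk> \<Longrightarrow> coordinates (x + y) = coordinates x + coordinates y"
  and coordinates_diff [simp]:
    "\<lbrakk>x \<in> C; y \<in> C\<rbrakk> \<Longrightarrow> coordinates (x - y) = coordinates x - coordinates y"
  and coordinates_scale [simp]:
    "x \<in> C \<Longrightarrow> coordinates (scale c x) = dext_scale scale c (coordinates x)"
  unfolding coordinates_def by simp_all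

lemma dext_carrier_iff:
  "(a, b, X, p, q) \<in> super_carrier (dext_grading H) \<longleftrightarrow> X \<in> HC"
proof
  assume "(a, b, X, p, q) \<in> super_carrier (dext_grading H)"
  then show "X \<in> HC"
    unfolding super_carrier_def dext_grading_def by auto
next
  assume "X \<in> HC"
  then obtain u v where "u \<in> H 0" "v \<in> H 1" "X = u + v" by (rule h.carrierE)
  then have "(a, 0, u, p, 0) \<in> dext_grading H 0" "(0, b, v, 0, q) \<in> dext_grading H 1"
      "(a, b, X, p, q) = (a, 0, u, p, 0) + (0, b, v, 0, q)"
    unfolding dext_grading_def by auto
  then show "(a, b, X, p, q) \<in> super_carrier (dext_grading H)"
    unfolding super_carrier_def by blast
qed

lemma coordinates_bij: "bij_betw coordinates C (super_carrier (dext_grading H))"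
proof (rule bij_betw_byWitness[where f' = "\<lambda>(a, b, X, p, q). scale a z0 + scale b z1 + X + scale p e0 + scale q e1"])
  show "\<forall>x\<in>C. (\<lambda>(a, b, X, p, q). scale a z0 + scale b z1 + X + scale p e0 + scale q e1) (coordinates x) = x"
    unfolding coordinates_def by (auto simp: decompose[symmetric])
  show "\<forall>U\<in>super_carrier (dext_grading H).
      coordinates ((\<lambda>(a, b, X, p, q). scale a z0 + scale b z1 + X + scale p e0 + scale q e1) U) = U"
    by (auto simp: dext_carrier_iff coordinates_def)
  show "coordinates ` C \<subseteq> super_carrier (dext_grading H)"
    unfolding coordinates_def by (auto simp: dext_carrier_iff)
  show "(\<lambda>(a, b, X, p, q). scale a z0 + scale b z1 + X + scale p e0 + scale q e1) `
      super_carrier (dext_grading H) \<subseteq> C"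
    by (auto simp: dext_carrier_iff)
qed

lemma coordinates_graded: "coordinates ` G d \<subseteq> dext_grading H d"
proof (rule image_subsetI)
  fix x assume x: "x \<in> G d"
  then have "P x \<in> H d" by (rule P_component)
  then show "coordinates x \<in> dext_grading H d"
    using x unfolding coordinates_def dext_grading_def by (cases "d = 0") auto
qed

lemma coordinates_br_hh:
  assumes X: "X \<in> HC" "Y \<in> HC"
  shows "coordinates (br X Y) = br_hh brh B D Db X Y"
proof -
  have C: "X \<in> C" "Y \<in> C" "br X Y \<in> perp" using X by auto
  have "B (br X Y) e0 = B (D X) Y"
    unfolding D_def using X C B_sym_even[of e0 "br X Y"] by (simp add: B_invariant)
  moreover have "B (br X Y) e1 = - B (Db X) Y"
    unfolding Db_def using X C B_sym_odd[of e1 "br X Y"] by (simp add: B_invariant)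
  ultimately show ?thesis
    unfolding coordinates_def br_hh_def brh_def using C by simp
qed

lemma coordinates_br_e0h:
  assumes X: "X \<in> HC" shows "coordinates (br e0 X) = br_e0h B D x1 X"
proof -
  have C: "X \<in> C" "br e0 X \<in> perp" using X by auto
  have "B (br e0 X) e0 = 0"
    using C B_sym_even[of e0 "br e0 X"] by (simp flip: B_invariant)
  moreover have "B (br e0 X) e1 = B x1 X"
    using X C B_sym_odd[of e1 "br e0 X"] by (simp add: x1_def br_e1_e0 flip: B_invariant)
  ultimately show ?thesis
    unfolding coordinates_def br_e0h_def D_def using C by simp
qed

lemma coordinates_br_e1h:
  assumes X: "X \<in> HC" shows "coordinates (br e1 X) = br_e1h B Db x0 x1 X"
proof -
  have C: "X \<in> C" "br e1 X \<in> perp" using X by auto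
  have "B (br e1 X) e0 = B x1 X"
    using X C B_sym_even[of e0 "br e1 X"] by (simp add: x1_def flip: B_invariant)
  moreover have "B (br e1 X) e1 = - B x0 X"
    using X C B_sym_odd[of e1 "br e1 X"] by (simp add: x0_def flip: B_invariant)
  ultimately show ?thesis
    unfolding coordinates_def br_e1h_def Db_def using C by simp
qed

lemma coordinates_br_e0e1: "coordinates (br e0 e1) = br_e0e1 x1 k"
  unfolding br_e0_e1 coordinates_def br_e0e1_def by simp

lemma coordinates_br_e1e1: "coordinates (br e1 e1) = br_e1e1 x0 k"
  unfolding br_e1_e1 coordinates_def br_e1e1_def by simp

lemma parity_aut_mem [simp]: assumes "X \<in> HC" shows "parity_aut H X \<in> HC"
proof -
  obtain u v where uv: "u \<in> H 0" "v \<in> H 1" "X = u + v" using assms by (rule h.carrierE)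
  then show ?thesis using h.parity_aut_sum[OF uv(1,2)] by auto
qed

lemma br_HC_e1:
  assumes "X \<in> HC" shows "br X e1 = - br e1 (parity_aut H X)"
proof -
  obtain u v where uv: "u \<in> H 0" "v \<in> H 1" "X = u + v" using assms by (rule h.carrierE)
  then show ?thesis
    using br_e1_right[of u v] H_subset h.parity_aut_sum[OF uv(1,2)] by auto
qed

lemma br_expand:
  assumes X: "X \<in> HC" "X' \<in> HC"
  shows "br (scale a z0 + scale b z1 + X + scale p e0 + scale q e1)
      (scale a' z0 + scale b' z1 + X' + scale p' e0 + scale q' e1)
    = br X X' + scale p (br e0 X') - scale p' (br e0 X) + scale q (br e1 X')
      - scale q' (br e1 (parity_aut H X)) + scale (p * q' - q * p') (br e0 e1) + scale (q * q') (br e1 e1)"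
proof -
  have C: "X \<in> C" "X' \<in> C" "br X X' \<in> C" "br e0 X' \<in> C" "br e1 X' \<in> C"
    using X by auto
  show ?thesis
    using C by (simp add: br_e0_right br_HC_e1[OF X(1)] br_e1_e0 algebra_simps)
qed

lemma coordinates_br:
  assumes "x \<in> C" "y \<in> C"
  shows "coordinates (br x y) = dext_bracket scale H brh B D Db x0 x1 k (coordinates x) (coordinates y)"
proof -
  have PP: "P x \<in> HC" "P y \<in> HC" "parity_aut H (P x) \<in> HC" using assms by auto
  have "br x y = br (P x) (P y) + scale (B z0 x) (br e0 (P y)) - scale (B z0 y) (br e0 (P x))
      + scale (B z1 x) (br e1 (P y)) - scale (B z1 y) (br e1 (parity_aut H (P x)))
      + scale (B z0 x * B z1 y - B z1 x * B z0 y) (br e0 e1) + scale (B z1 x * B z1 y) (br e1 e1)"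
    using br_expand[OF PP(1,2), of "B x e0" "B x e1" "B z0 x" "B z1 x" "B y e0" "B y e1" "B z0 y" "B z1 y"]
    unfolding decompose[symmetric] .
  then have "coordinates (br x y) = coordinates (br (P x) (P y) + scale (B z0 x) (br e0 (P y))
      - scale (B z0 y) (br e0 (P x))
      + scale (B z1 x) (br e1 (P y)) - scale (B z1 y) (br e1 (parity_aut H (P x)))
      + scale (B z0 x * B z1 y - B z1 x * B z0 y) (br e0 e1) + scale (B z1 x * B z1 y) (br e1 e1))"
    by (rule arg_cong)
  also have "\<dots> = br_hh brh B D Db (P x) (P y)
     + dext_scale scale (B z0 x) (br_e0h B D x1 (P y))
     - dext_scale scale (B z0 y) (br_e0h B D x1 (P x))
     + dext_scale scale (B z1 x) (br_e1h B Db x0 x1 (P y))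
     - dext_scale scale (B z1 y) (br_e1h B Db x0 x1 (parity_aut H (P x)))
     + dext_scale scale (B z0 x * B z1 y - B z1 x * B z0 y) (br_e0e1 x1 k)
     + dext_scale scale (B z1 x * B z1 y) (br_e1e1 x0 k)"
  proof -
    have C: "P x \<in> C" "P y \<in> C" "parity_aut H (P x) \<in> C" using PP HC_subset by blast+
    show ?thesis
      using C in_carrier
      by (simp only: coordinates_add coordinates_diff coordinates_scale br_mem carrier_closed
          coordinates_br_hh[OF PP(1,2)] coordinates_br_e0h[OF PP(1)] coordinates_br_e0h[OF PP(2)]
          coordinates_br_e1h[OF PP(2)] coordinates_br_e1h[OF PP(3)]
          coordinates_br_e0e1 coordinates_br_e1e1)
  qed
  finally show ?thesis unfolding coordinates_def[of x] coordinates_def[of y] dext_bracket.simps .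
qed

lemma B_expand:
  assumes X: "X \<in> HC" "X' \<in> HC"
  shows "B (scale a z0 + scale b z1 + X + scale p e0 + scale q e1)
      (scale a' z0 + scale b' z1 + X' + scale p' e0 + scale q' e1)
    = B X X' + a * p' + p * a' + b * q' - q * b'"
  using X by (simp add: algebra_simps)

lemma B_coordinates:
  assumes "x \<in> C" "y \<in> C"
  shows "dext_form B (coordinates x) (coordinates y) = B x y"
proof -
  have "P x \<in> HC" "P y \<in> HC" using assms by auto
  from B_expand[OF this, of "B x e0" "B x e1" "B z0 x" "B z1 x" "B y e0" "B y e1" "B z0 y" "B z1 y"]
  have "B x y = B (P x) (P y) + B x e0 * B z0 y + B z0 x * B y e0 + B x e1 * B z1 y - B z1 x * B y e1"
    unfolding decompose[symmetric] .
  then show ?thesis unfolding coordinates_def dext_form.simps by (rule sym)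
qed

lemma coordinates_\<delta>_h:
  assumes X: "X \<in> HC"
  shows "coordinates (\<delta> X) = (- B c1 X, - B c0 X, \<delta>h X, 0, 0)"
proof -
  have C: "X \<in> C" "\<delta> X \<in> perp" using X by auto
  have "B (\<delta> X) e0 = - B c1 X"
    unfolding c1_def using X C B_sym_even[of e0 "\<delta> X"] \<delta>_skew_even[of e0 X] by simp
  moreover have "B (\<delta> X) e1 = - B c0 X"
    unfolding c0_def using X C B_sym_odd[of e1 "\<delta> X"] \<delta>_skew_odd[of e1 X] by simp
  ultimately show ?thesis unfolding coordinates_def \<delta>h_def using C by simp
qed

lemma coordinates_\<delta>:
  assumes "x \<in> C"
  shows "coordinates (\<delta> x) = dext_derivation scale B \<delta>h c0 c1 \<alpha> l (coordinates x)"
proof -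
  have P: "P x \<in> HC" "P x \<in> C" using assms by auto
  have basis: "coordinates (\<delta> z0) = (0, l, 0, 0, 0)" "coordinates (\<delta> z1) = (l, 0, 0, 0, 0)"
      "coordinates (\<delta> e0) = (0, \<alpha>, c1, 0, l)" "coordinates (\<delta> e1) = (- \<alpha>, 0, c0, - l, 0)"
    unfolding \<delta>_e0 \<delta>_e1 coordinates_def by simp_all
  have "\<delta> x = \<delta> (scale (B x e0) z0 + scale (B x e1) z1 + P x + scale (B z0 x) e0 + scale (B z1 x) e1)"
    unfolding decompose[symmetric] ..
  also have "\<dots> = scale (B x e0) (\<delta> z0) + scale (B x e1) (\<delta> z1) + \<delta> (P x)
      + scale (B z0 x) (\<delta> e0) + scale (B z1 x) (\<delta> e1)"
    using P(2) in_carrier by (simp only: \<delta>_add \<delta>_scale carrier_closed)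
  finally have "coordinates (\<delta> x) = coordinates (scale (B x e0) (\<delta> z0) + scale (B x e1) (\<delta> z1) + \<delta> (P x)
      + scale (B z0 x) (\<delta> e0) + scale (B z1 x) (\<delta> e1))"
    by (rule arg_cong)
  also have "\<dots> = dext_scale scale (B x e0) (0, l, 0, 0, 0) + dext_scale scale (B x e1) (l, 0, 0, 0, 0)
      + (- B c1 (P x), - B c0 (P x), \<delta>h (P x), 0, 0)
      + dext_scale scale (B z0 x) (0, \<alpha>, c1, 0, l) + dext_scale scale (B z1 x) (- \<alpha>, 0, c0, - l, 0)"
    using P(2) in_carrier \<delta>_mem
    by (simp only: coordinates_add coordinates_scale carrier_closed basis coordinates_\<delta>_h[OF P(1)])
  finally show ?thesis unfolding coordinates_def[of x] dext_derivation.simps .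
qed

lemma coordinates_isometric_iso:
  "isometric_iso scale G br B \<omega> (dext_scale scale) (dext_grading H)
     (dext_bracket scale H brh B D Db x0 x1 k) (dext_form B) (dext_omega scale B \<delta>h c0 c1 \<alpha> l) coordinates"
  unfolding isometric_iso_def linear_map_on_def dext_omega_def
  using coordinates_bij coordinates_graded coordinates_br B_coordinates
  by (simp add: coordinates_\<delta>[symmetric] \<omega>_eq)

lemma is_double_extension_of_reduction:
  "is_generalized_double_extension scale G br B \<omega> scale H brh B \<omega>"
  unfolding is_generalized_double_extension_def
  using reduction_data coordinates_isometric_iso by blast

end

section \<open>Choice of the hyperbolic planes\<close>

context even_quadratic_odd_symplectic
begin

text \<open>
  Adding a multiple of the isotropic vector \<open>z\<close> to a vector paired with
  \<open>z\<close> makes it isotropic.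
\<close>
lemma dual_even_vector_exists:
  assumes "z \<in> G 0" "z \<noteq> 0" "B z z = 0"
  shows "\<exists>e\<in>G 0. B z e = 1 \<and> B e e = 0"
proof -
  obtain y where y: "y \<in> C" "B z y \<noteq> 0"
    using B_nondegenerate assms(1,2) unfolding nondegenerate_on_def by blast
  obtain u v where uv: "u \<in> G 0" "v \<in> G 1" "y = u + v" using y(1) by (rule carrierE)
  define t where "t = scale (inverse (B z u)) u"
  have "B z u \<noteq> 0" using y uv assms(1) by auto
  then have t: "t \<in> G 0" "t \<in> C" "B z t = 1" unfolding t_def using uv(1) assms(1) by auto
  define e where "e = t - scale (B t t / 2) z"
  have "B t z = 1" using B_sym_even[OF assms(1) t(2)] t(3) by simp
  then have "B e e = B t t - B t t / 2 - B t t / 2"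
    unfolding e_def using t assms by (simp add: component_subset)
  then have "B e e = 0" by simp
  moreover have "B z e = 1" "e \<in> G 0" unfolding e_def using t assms by (simp_all add: component_subset)
  ultimately show ?thesis by blast
qed

lemma dual_odd_vector_exists:
  assumes "z \<in> G 1" "z \<noteq> 0"
  shows "\<exists>e\<in>G 1. B z e = 1"
proof -
  obtain y where y: "y \<in> C" "B z y \<noteq> 0"
    using B_nondegenerate assms unfolding nondegenerate_on_def by blast
  obtain u v where uv: "u \<in> G 0" "v \<in> G 1" "y = u + v" using y(1) by (rule carrierE)
  have "B z v \<noteq> 0" using y uv assms(1) by auto
  then have "B z (scale (inverse (B z v)) v) = 1" using uv(2) assms(1) by (simp add: component_subset)
  then show ?thesis using uv(2) component_closed(4) by blast
qed

end

theorem proposition5p4: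
  fixes scale :: "'k::{alg_closed_field, field_char_0} \<Rightarrow> 'v::ab_group_add \<Rightarrow> 'v"
    and G :: "bit \<Rightarrow> 'v set"
    and br :: "'v \<Rightarrow> 'v \<Rightarrow> 'v"
    and B \<omega> :: "'v \<Rightarrow> 'v \<Rightarrow> 'k"
  assumes "even_quadratic_odd_symplectic scale G br B \<omega>"
    and "super_carrier G \<noteq> {0}"
  shows "\<exists>H br\<^sub>h B\<^sub>h \<omega>\<^sub>h.
    even_quadratic_odd_symplectic scale H br\<^sub>h B\<^sub>h \<omega>\<^sub>h \<and>
    is_generalized_double_extension scale G br B \<omega> scale H br\<^sub>h B\<^sub>h \<omega>\<^sub>h"
proof -
  interpret g: even_quadratic_odd_symplectic scale G br B \<omega> by fact
  obtain \<delta> where \<delta>: "\<forall>x\<in>super_carrier G. \<delta> x \<in> super_carrier G \<and>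
      (\<forall>y\<in>super_carrier G. \<omega> x y = B (\<delta> x) y)"
    using g.associated_map_exists by blast
  interpret g: even_quadratic_with_derivation scale G br B \<omega> \<delta>
    by unfold_locales (use \<delta> in blast)+
  obtain z0 l where z0: "z0 \<in> G 0" "z0 \<noteq> 0" and l: "l \<noteq> 0"
    and central: "\<forall>x\<in>g.C. br x z0 = 0" and eigen: "\<delta> (\<delta> z0) = scale (l * l) z0"
    using g.even_central_eigenvector_exists[OF assms(2)] by blast
  define z1 where "z1 = scale (inverse l) (\<delta> z0)"
  have z1: "z1 \<in> G 1" unfolding z1_def using z0(1) by simp
  have \<delta>z0: "\<delta> z0 = scale l z1" unfolding z1_def using l by simp
  have \<delta>z1: "\<delta> z1 = scale l z0" unfolding z1_def using l z0(1) eigen by (simp add: g.component_subset)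
  have "\<delta> z0 \<noteq> 0" using g.\<delta>_injective z0 by blast
  then have z1_nonzero: "z1 \<noteq> 0" using \<delta>z0 by auto
  have central1: "br x z1 = 0" if x: "x \<in> g.C" for x
    using g.br_\<delta>_central[OF _ central x] z0(1) x unfolding z1_def by auto
  \<comment> \<open>Skewness of \<open>\<delta>\<close> relates \<open>B z1 z1\<close>, which vanishes because \<open>z1\<close> is odd, to \<open>B z0 z0\<close>.\<close>
  have z1z1: "B z1 z1 = 0"
  proof -
    have "B z1 z1 = - B z1 z1" by (rule g.B_sym_odd[OF z1 g.component_subset[OF z1]])
    then show ?thesis by (simp add: eq_neg_iff_add_eq_0 flip: mult_2)
  qed
  have "l * B z1 z1 = - (l * B z0 z0)"
    using g.\<delta>_skew_even[OF z0(1) g.component_subset[OF z1]] z0(1) z1 unfolding \<delta>z0 \<delta>z1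
    by (simp add: g.component_subset)
  then have z0z0: "B z0 z0 = 0" using z1z1 l by simp
  obtain e0 where e0: "e0 \<in> G 0" "B z0 e0 = 1" "B e0 e0 = 0"
    using g.dual_even_vector_exists[OF z0 z0z0] by blast
  obtain e1 where e1: "e1 \<in> G 1" "B z1 e1 = 1"
    using g.dual_odd_vector_exists[OF z1 z1_nonzero] by blast
  interpret r: central_hyperbolic_planes scale G br B \<omega> \<delta> z0 z1 e0 e1 l
    by unfold_locales (use z0 z1 e0 e1 central central1 \<delta>z0 \<delta>z1 z0z0 l in auto)
  show ?thesis
    using r.reduction_even_quadratic_odd_symplectic r.is_double_extension_of_reduction by blast
qed

end
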